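(* Let $n\ge 2$, $k\ge1$, $t\ge1$ be integers and let $D$ be a target distribution on $G=P_n^{(k)}$ of size $t$. Then $\pi(G,D)\le p_t(n,k)-s(D)+1$. In addition, if $G$ is $t$-wide then $G$ is $D$-small, while if $G$ is strictly $t$-long then every configuration $C$ on $G$ of size $|C|\ge p_t(n,k)-s(D)+1$ solves every target $v$ with $D(v)>0$ with cost at most $2^{\mathrm{ecc}_G(v)}$.
   Context: $P_n^{(k)}$ has vertices $v_1,\dots,v_n$ with $v_i\sim v_j$ iff $1\le|i-j|\le k$. For $n\ge2$: $d=\lfloor (n-2)/k\rfloor+1$, $b=(n-2)-k(d-1)$, $p_t(n,k)=\max\{t2^d+b,\ 2t+n-2\}$. Let $t_0=1$ if $d=1$ and $t_0=k(d-1)/(2^d-2)$ if $d\ge 2$; $G$ is $t$-wide if $t\le t_0$ and strictly $t$-long if $t>\lceil t_0\rceil$. A configuration is $C:V\to\mathbb{N}$ with $|C|=\sum_vC(v)$; a target distribution is $D:V\to\mathbb{N}$ with size $\sum_vD(v)$ and $s(D)=|\{v:D(v)>0\}|$. A pebbling step from a vertex with at least two pebbles to a neighbor removes two pebbles there and adds one to the neighbor. $C$ is $D$-solvable if some sequence of pebbling steps results in at least $D(v)$ pebbles on every $v$ simultaneously; $\pi(G,D)$ is the least $m$ such that every configuration of size at least $m$ is $D$-solvable. The potential of $C$ with respect to $D$ is $\mathrm{pot}_D(C)=\sum_v\big(\min\{C(v),D(v)\}+\lfloor\max\{C(v)-D(v),0\}/2\rfloor\big)$. $G$ is $D$-small if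 some configuration $C$ that is not $D$-solvable and has $|C|=\pi(G,D)-1$ satisfies $\mathrm{pot}_D(C)=|D|-1$. The cost of a sequence of $c$ pebbling steps placing a pebble on $v$ is $c+1$; "$C$ solves $v$ with cost at most $x$" means such a sequence from $C$ exists with cost at most $x$. $\mathrm{ecc}_G(v)$ is the largest distance in $G$ from $v$. *)

theory Defs
  imports Complex_Main "Graph_Theory.Pair_Digraph"
begin

text \<open>
  A finite simple graph is a \<open>pair_graph\<close>: a finite loop-free digraph with symmetric arc relation.
  Configurations and target distributions on \<open>G\<close> are functions \<open>'a \<Rightarrow> nat\<close>; their values outside
  \<open>pverts G\<close> are irrelevant, since sums range over \<open>pverts G\<close> and pebbles move only along arcs.
\<close>

definition path_power :: "nat \<Rightarrow> nat \<Rightarrow> nat pair_pre_digraph" where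
  "path_power n k =
     \<lparr> pverts = {1..n},
       parcs = {(i, j). i \<in> {1..n} \<and> j \<in> {1..n} \<and>
                        1 \<le> \<bar>int i - int j\<bar> \<and> \<bar>int i - int j\<bar> \<le> int k} \<rparr>"

lemma pair_graph_path_power: "pair_graph (path_power n k)"
proof
  show "finite (pverts (path_power n k))"
    by (simp add: path_power_def)
  show "finite (parcs (path_power n k))"
    by (rule finite_subset[of _ "{1..n} \<times> {1..n}"]) (auto simp: path_power_def)
  show "symmetric (path_power n k)"
    by (auto simp: symmetric_def path_power_def intro!: symI)
qed (auto simp: path_power_def)

definition graph_dist :: "'a pair_pre_digraph \<Rightarrow> 'a \<Rightarrow> 'a \<Rightarrow> nat" where
  "graph_dist G u v = (LEAST m. (u, v) \<in> parcs G ^^ m)"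

definition eccentricity :: "'a pair_pre_digraph \<Rightarrow> 'a \<Rightarrow> nat" where
  "eccentricity G v = Max (graph_dist G v ` pverts G)"

definition dist_size :: "'a pair_pre_digraph \<Rightarrow> ('a \<Rightarrow> nat) \<Rightarrow> nat" where
  "dist_size G C = (\<Sum>v\<in>pverts G. C v)"

definition dist_support :: "'a pair_pre_digraph \<Rightarrow> ('a \<Rightarrow> nat) \<Rightarrow> nat" where
  "dist_support G D = card {v \<in> pverts G. D v > 0}"

definition pebbling_step :: "'a pair_pre_digraph \<Rightarrow> ('a \<Rightarrow> nat) \<Rightarrow> ('a \<Rightarrow> nat) \<Rightarrow> bool" where
  "pebbling_step G C C' \<longleftrightarrow>
     (\<exists>u v. (u, v) \<in> parcs G \<and> 2 \<le> C u \<and> C' = C(u := C u - 2, v := C v + 1))"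

definition solvable :: "'a pair_pre_digraph \<Rightarrow> ('a \<Rightarrow> nat) \<Rightarrow> ('a \<Rightarrow> nat) \<Rightarrow> bool" where
  "solvable G D C \<longleftrightarrow> (\<exists>C'. (pebbling_step G)\<^sup>*\<^sup>* C C' \<and> (\<forall>v\<in>pverts G. D v \<le> C' v))"

definition pebbling_number :: "'a pair_pre_digraph \<Rightarrow> ('a \<Rightarrow> nat) \<Rightarrow> nat" where
  "pebbling_number G D = (LEAST m. \<forall>C. m \<le> dist_size G C \<longrightarrow> solvable G D C)"

text \<open>Truncated subtraction on \<open>nat\<close> gives \<open>max {C v - D v, 0}\<close>.\<close>

definition potential :: "'a pair_pre_digraph \<Rightarrow> ('a \<Rightarrow> nat) \<Rightarrow> ('a \<Rightarrow> nat) \<Rightarrow> nat" where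
  "potential G D C = (\<Sum>v\<in>pverts G. min (C v) (D v) + (C v - D v) div 2)"

definition small :: "'a pair_pre_digraph \<Rightarrow> ('a \<Rightarrow> nat) \<Rightarrow> bool" where
  "small G D \<longleftrightarrow>
     (\<exists>C. \<not> solvable G D C \<and> dist_size G C + 1 = pebbling_number G D \<and>
          potential G D C + 1 = dist_size G D)"

text \<open>A sequence of \<open>c\<close> pebbling steps that results in a pebble on \<open>v\<close> has cost \<open>c + 1\<close>.\<close>

definition solves_with_cost_at_most ::
    "'a pair_pre_digraph \<Rightarrow> ('a \<Rightarrow> nat) \<Rightarrow> 'a \<Rightarrow> nat \<Rightarrow> bool" where
  "solves_with_cost_at_most G C v x \<longleftrightarrow>
     (\<exists>c C'. (pebbling_step G ^^ c) C C' \<and> 1 \<le> C' v \<and> c + 1 \<le> x)"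

text \<open>
  The subtractions in \<open>pp_d\<close>, \<open>pp_b\<close> and \<open>pp_bound\<close> are exact whenever \<open>n \<ge> 2\<close>, because
  \<open>k * ((n - 2) div k) \<le> n - 2\<close>.
\<close>

definition pp_d :: "nat \<Rightarrow> nat \<Rightarrow> nat" where
  "pp_d n k = (n - 2) div k + 1"

definition pp_b :: "nat \<Rightarrow> nat \<Rightarrow> nat" where
  "pp_b n k = (n - 2) - k * (pp_d n k - 1)"

definition pp_bound :: "nat \<Rightarrow> nat \<Rightarrow> nat \<Rightarrow> nat" where
  "pp_bound t n k = max (t * 2 ^ pp_d n k + pp_b n k) (2 * t + (n - 2))"

definition pp_t0 :: "nat \<Rightarrow> nat \<Rightarrow> real" where
  "pp_t0 n k = (if pp_d n k = 1 then 1
     else real k * (real (pp_d n k) - 1) / (2 ^ pp_d n k - 2))"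

definition wide :: "nat \<Rightarrow> nat \<Rightarrow> nat \<Rightarrow> bool" where
  "wide t n k \<longleftrightarrow> real t \<le> pp_t0 n k"

definition strictly_long :: "nat \<Rightarrow> nat \<Rightarrow> nat \<Rightarrow> bool" where
  "strictly_long t n k \<longleftrightarrow> int t > \<lceil>pp_t0 n k\<rceil>"

end

theory Submission
  imports Defs
begin

text \<open>
  After matching pebbles that already sit on targets, assume \<open>C = 0\<close> where \<open>D > 0\<close>. A configuration is
  described by its pairs of pebbles and by the vertices carrying an odd pebble: one pebble moved onto
  an odd vertex makes a new pair, so pairs travel through odd vertices without loss, and a
  pair is lost only when no odd vertex is available among \<open>k\<close> consecutive ones. In terms of the number
  of pairs and the number \<open>z\<close> of even non-target vertices, the size hypothesis says
  \<open>t * 2 ^ (r + 1) + z \<le> 2 * pairs + r * k + 1\<close> for all \<open>r\<close> with \<open>r * k \<le> n - 2\<close>.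

  This inequality suffices on every subinterval of the path. If the leftmost vertex is a target, sweep
  to the right with a queue of demands, always serving the oldest demand first. A demand
  that has waited for \<open>k\<close> vertices must be served by two new pebbles, and at such a moment the length of
  the queue is twice its length \<open>k\<close> vertices earlier, minus the pebbles of the window in between. Hence
  the queue becomes empty, and the rest of the interval still satisfies the inequality.
  If neither end is a target, split at a target vertex: the inequality cannot fail
  on both sides even if one unit of the target is counted twice.
\<close>

section \<open>Pebbling moves\<close>

lemma pebbling_step_add:
  assumes "pebbling_step G C C'"
  shows "pebbling_step G (\<lambda>u. C u + K u) (\<lambda>u. C' u + K u)"
proof -
  obtain u v where uv: "(u, v) \<in> parcs G" "2 \<le> C u" "C' = C(u := C u - 2, v := C v + 1)"
    using assms unfolding pebbling_step_def by blast
  have "(\<lambda>x. C' x + K x) =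
      (\<lambda>x. C x + K x)(u := (C u + K u) - 2, v := (C v + K v) + 1)"
    using uv by (auto simp: fun_eq_iff)
  then show ?thesis
    unfolding pebbling_step_def using uv by (intro exI[of _ u] exI[of _ v]) auto
qed

lemma pebbling_steps_add:
  assumes "(pebbling_step G ^^ c) C C'"
  shows "(pebbling_step G ^^ c) (\<lambda>u. C u + K u) (\<lambda>u. C' u + K u)"
  using assms
proof (induction c arbitrary: C')
  case (Suc c)
  then obtain B where "(pebbling_step G ^^ c) C B" "pebbling_step G B C'"
    by auto
  then show ?case
    using Suc.IH pebbling_step_add by (metis relpowp_Suc_I)
qed simp

lemma pebbling_rtranclp_add:
  assumes "(pebbling_step G)\<^sup>*\<^sup>* C C'"
  shows "(pebbling_step G)\<^sup>*\<^sup>* (\<lambda>u. C u + K u) (\<lambda>u. C' u + K u)"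
  using assms pebbling_steps_add by (metis rtranclp_power)

lemma solvable_of_le: "(\<And>v. v \<in> pverts G \<Longrightarrow> D v \<le> C v) \<Longrightarrow> solvable G D C"
  unfolding solvable_def by blast

text \<open>Idle pebbles never hinder a move, so the moves for \<open>C1\<close> run while
  \<open>C2\<close> waits, and then those for \<open>C2\<close> run on top of the result. Partial
  solutions are glued in this way.\<close>

lemma solvable_add:
  assumes "solvable G D1 C1" and "solvable G D2 C2"
  shows "solvable G (\<lambda>u. D1 u + D2 u) (\<lambda>u. C1 u + C2 u)"
proof -
  obtain B1 B2 where B: "(pebbling_step G)\<^sup>*\<^sup>* C1 B1" "\<forall>v\<in>pverts G. D1 v \<le> B1 v"
    "(pebbling_step G)\<^sup>*\<^sup>* C2 B2" "\<forall>v\<in>pverts G. D2 v \<le> B2 v"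
    using assms unfolding solvable_def by blast
  have "(pebbling_step G)\<^sup>*\<^sup>* (\<lambda>u. C1 u + C2 u) (\<lambda>u. B1 u + C2 u)"
    using pebbling_rtranclp_add B by blast
  also have "(pebbling_step G)\<^sup>*\<^sup>* (\<lambda>u. B1 u + C2 u) (\<lambda>u. B1 u + B2 u)"
    using pebbling_rtranclp_add[OF B(3), of B1] by (simp add: add.commute)
  finally show ?thesis
    unfolding solvable_def using B by (meson add_mono)
qed

lemma solvable_mono:
  assumes "solvable G D C" and "\<And>v. v \<in> pverts G \<Longrightarrow> D' v \<le> D v" and "\<And>v. C v \<le> C' v"
  shows "solvable G D' C'"
proof -
  have "solvable G (\<lambda>u. D u + 0) (\<lambda>u. C u + (C' u - C u))"
    by (rule solvable_add[OF assms(1)]) (simp add: solvable_of_le)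
  moreover have "(\<lambda>u. C u + (C' u - C u)) = C'"
    using assms(3) by auto
  ultimately show ?thesis
    using assms(2) unfolding solvable_def by (metis add.right_neutral order_trans)
qed

text \<open>Reaching \<open>D\<close> controls the result only on \<open>pverts G\<close>, while
  \<open>solvable_mono\<close> compares configurations everywhere; hence \<open>D\<close> has to
  vanish outside.\<close>

lemma solvable_trans:
  assumes "solvable G D C" and "\<And>u. u \<notin> pverts G \<Longrightarrow> D u = 0" and "solvable G D' D"
  shows "solvable G D' C"
proof -
  obtain B where B: "(pebbling_step G)\<^sup>*\<^sup>* C B" "\<forall>v\<in>pverts G. D v \<le> B v"
    using assms unfolding solvable_def by blast
  have "solvable G D' B"
    using solvable_mono[OF assms(3)] B(2) assms(2) by (metis le_refl zero_le)
  then show ?thesis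
    using B(1) unfolding solvable_def by (meson rtranclp_trans)
qed

lemma solvable_unit_move:
  assumes "(y, w) \<in> parcs G" and "y \<noteq> w"
  shows "solvable G (\<lambda>u. if u = w then 1 else 0) (\<lambda>u. if u = y then 2 else 0)"
proof -
  have "pebbling_step G (\<lambda>u. if u = y then 2 else 0) (\<lambda>u. if u = w then 1 else 0)"
    unfolding pebbling_step_def
    by (rule exI[of _ y], rule exI[of _ w]) (use assms in \<open>auto simp: fun_eq_iff\<close>)
  then show ?thesis
    unfolding solvable_def by blast
qed

text \<open>Induction on the number of demands, removing one at a time. In the sweep,
  \<open>y\<close> is the vertex that serves several waiting demands at once.\<close>

lemma solvable_spread:
  assumes "finite (pverts G)" and "\<And>u. u \<in> pverts G \<Longrightarrow> 0 < \<delta> u \<Longrightarrow> (y, u) \<in> parcs G \<and> y \<noteq> u"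
  shows "solvable G \<delta> (\<lambda>u. if u = y then 2 * sum \<delta> (pverts G) else 0)"
  using assms(2)
proof (induction "sum \<delta> (pverts G)" arbitrary: \<delta>)
  case 0
  then show ?case using assms(1) by (simp add: solvable_of_le)
next
  case (Suc N)
  then obtain w where w: "w \<in> pverts G" "0 < \<delta> w"
    by (metis gr0I sum.neutral zero_less_Suc less_numeral_extra(3))
  define \<delta>' where "\<delta>' = \<delta>(w := \<delta> w - 1)"
  have "sum \<delta> (pverts G) = Suc (sum \<delta>' (pverts G))"
    using w assms(1) by (simp add: sum.remove[of _ w] \<delta>'_def)
  then have N: "N = sum \<delta>' (pverts G)"
    using Suc.hyps(2) by simp
  have "solvable G \<delta>' (\<lambda>u. if u = y then 2 * sum \<delta>' (pverts G) else 0)"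
    by (rule Suc.hyps(1)[OF N]) (use Suc.prems in \<open>auto simp: \<delta>'_def split: if_splits\<close>)
  moreover have "solvable G (\<lambda>u. if u = w then 1 else 0) (\<lambda>u. if u = y then 2 else 0)"
    using solvable_unit_move Suc.prems w by metis
  ultimately have "solvable G (\<lambda>u. \<delta>' u + (if u = w then 1 else 0))
      (\<lambda>u. (if u = y then 2 * sum \<delta>' (pverts G) else 0) + (if u = y then 2 else 0))"
    by (rule solvable_add)
  moreover have "(\<lambda>u. \<delta>' u + (if u = w then 1 else 0)) = \<delta>"
    using w by (auto simp: \<delta>'_def)
  moreover have "(\<lambda>u. (if u = y then 2 * sum \<delta>' (pverts G) else 0) + (if u = y then 2 else 0)) =
      (\<lambda>u. if u = y then 2 * sum \<delta> (pverts G) else 0)"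
    using \<open>sum \<delta> (pverts G) = Suc (sum \<delta>' (pverts G))\<close> by auto
  ultimately show ?case by simp
qed

lemma pverts_path_power [simp]: "pverts (path_power n k) = {1..n}"
  by (simp add: path_power_def)

lemma arc_path_power_iff:
  "(u, v) \<in> parcs (path_power n k) \<longleftrightarrow>
     u \<in> {1..n} \<and> v \<in> {1..n} \<and> u \<noteq> v \<and> u \<le> v + k \<and> v \<le> u + k"
  unfolding path_power_def by auto

section \<open>Backlog of a queue of demands\<close>

text \<open>Vertex \<open>x\<close> of the sweep has \<open>c x\<close> pebbles and creates \<open>d x\<close> demands. By the time \<open>x\<close> is
  passed, \<open>served x\<close> of the \<open>arrived x\<close> demands have been served, the oldest first: all those that arrived
  up to \<open>x - k\<close>, and at least as many as the pebbles on \<open>x\<close> allow when an odd pebble is completed by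
  one new demand at \<open>x\<close>. Serving \<open>j\<close> demands from \<open>x\<close> creates \<open>2 * j - c x\<close> demands at \<open>x\<close>.\<close>

fun served :: "nat \<Rightarrow> (nat \<Rightarrow> nat) \<Rightarrow> (nat \<Rightarrow> nat) \<Rightarrow> nat \<Rightarrow> nat" where
  "served k c d 0 = 0"
| "served k c d (Suc x) =
     max (if 0 < k \<and> k \<le> Suc x
          then sum d {..Suc x - k} + 2 * served k c d (Suc x - k) - sum c {..Suc x - k} else 0)
       (served k c d x + (c (Suc x) + 1) div 2)"

definition arrived :: "nat \<Rightarrow> (nat \<Rightarrow> nat) \<Rightarrow> (nat \<Rightarrow> nat) \<Rightarrow> nat \<Rightarrow> nat" where
  "arrived k c d x = sum d {..x} + 2 * served k c d x - sum c {..x}"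

lemma served_Suc:
  "0 < k \<Longrightarrow> served k c d (Suc x) =
     max (if k \<le> Suc x then arrived k c d (Suc x - k) else 0)
       (served k c d x + (c (Suc x) + 1) div 2)"
  by (simp add: arrived_def del: sum.atMost_Suc)

text \<open>Each vertex passed serves at least half of its own pebbles, rounded up; therefore the
  subtraction in \<open>arrived\<close> never truncates. Vertex \<open>0\<close> serves nothing,
  hence \<open>c 0 = 0\<close>.\<close>

lemma sum_le_served:
  assumes "c 0 = 0"
  shows "sum c {..x} \<le> 2 * served k c d x"
proof (induction x)
  case (Suc x)
  have "c (Suc x) \<le> 2 * ((c (Suc x) + 1) div 2)" by linarith
  moreover have "served k c d x + (c (Suc x) + 1) div 2 \<le> served k c d (Suc x)" by simp
  ultimately show ?case using Suc by (simp del: served.simps)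
qed (simp add: assms)

lemma arrived_eq:
  "c 0 = 0 \<Longrightarrow> arrived k c d x + sum c {..x} = sum d {..x} + 2 * served k c d x"
  using sum_le_served[of c x k d] by (simp add: arrived_def)

lemma served_step_ge: "served k c d x + (c (Suc x) + 1) div 2 \<le> served k c d (Suc x)"
  by simp

lemma arrived_Suc:
  assumes "c 0 = 0"
  shows "arrived k c d (Suc x) + c (Suc x) + 2 * served k c d x =
    arrived k c d x + d (Suc x) + 2 * served k c d (Suc x)"
  using arrived_eq[of c k d x, OF assms] arrived_eq[of c k d "Suc x", OF assms]
  by (simp del: served.simps)

lemma mono_arrived:
  assumes "c 0 = 0"
  shows "mono (arrived k c d)"
proof (rule mono_iff_le_Suc[THEN iffD2], intro allI)
  fix x
  show "arrived k c d x \<le> arrived k c d (Suc x)"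
    using arrived_Suc[of c k d x, OF assms] served_step_ge[of k c d x] by linarith
qed

text \<open>\<open>r\<close> counts the windows of \<open>k\<close> vertices in which service was
  forced, and \<open>Z\<close> even non-target vertices inside them. Each such window doubles the
  queue, which gives the power of two; \<open>Z \<le> r * k\<close> is carried along to absorb the
  second copy of \<open>Z\<close> that the doubling creates.\<close>

lemma backlog_bound:
  fixes c d :: "nat \<Rightarrow> nat"
  assumes k: "0 < k" and c0: "c 0 = 0" and cd: "\<And>i. 0 < d i \<Longrightarrow> c i = 0"
  shows "\<exists>r Z. r * k \<le> x \<and> Z \<le> (\<Sum>i\<le>x. of_bool (d i = 0 \<and> even (c i))) \<and> Z \<le> r * k \<and>
    2 * arrived k c d x + 2 * (\<Sum>i\<le>x. c i div 2) + r * k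
      \<le> sum d {..x} * 2 ^ (r + 1) + Z + 2 * served k c d x"
proof (induction x rule: less_induct)
  case (less x)
  let ?ev = "\<lambda>i. of_bool (d i = 0 \<and> even (c i)) :: nat"
  show ?case
  proof (cases x)
    case 0
    then show ?thesis by (intro exI[of _ 0]) (simp add: arrived_def c0)
  next
    case (Suc y)
    show ?thesis
    proof (cases "served k c d x = served k c d y + (c x + 1) div 2")
      case True
      obtain r Z where rZ: "r * k \<le> y" "Z \<le> sum ?ev {..y}" "Z \<le> r * k"
        "2 * arrived k c d y + 2 * (\<Sum>i\<le>y. c i div 2) + r * k
          \<le> sum d {..y} * 2 ^ (r + 1) + Z + 2 * served k c d y"
        using less.IH[of y] Suc by blast
      have "sum ?ev {..x} = sum ?ev {..y} + ?ev x"
        using Suc by simp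
      moreover have "2 * d x \<le> d x * 2 ^ (r + 1)" by simp
      moreover have halves: "(c x + 1) div 2 + c x div 2 = c x" by linarith
      have "2 * arrived k c d x + 2 * (c x div 2) + 2 * served k c d y =
          2 * arrived k c d y + 2 * d x + 2 * served k c d x"
        using arrived_Suc[of c k d y, OF c0] True halves unfolding Suc by linarith
      moreover have "(\<Sum>i\<le>x. c i div 2) = (\<Sum>i\<le>y. c i div 2) + c x div 2"
        "sum d {..x} * 2 ^ (r + 1) = sum d {..y} * 2 ^ (r + 1) + d x * 2 ^ (r + 1)"
        using Suc by (simp_all add: algebra_simps)
      ultimately show ?thesis
        using rZ Suc by (intro exI[of _ r] exI[of _ Z]) linarith
    next
      case False
      then have kx: "k \<le> x" and sx: "served k c d x = arrived k c d (x - k)"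
        using served_Suc[OF k, of c d y] Suc by (auto simp: max_def split: if_splits)
      let ?W = "{x - k<..x}" and ?y = "x - k"
      obtain r Z where rZ: "r * k \<le> ?y" "Z \<le> sum ?ev {..?y}" "Z \<le> r * k"
        "2 * arrived k c d ?y + 2 * (\<Sum>i\<le>?y. c i div 2) + r * k
          \<le> sum d {..?y} * 2 ^ (r + 1) + Z + 2 * served k c d ?y"
        using less.IH[of ?y] Suc k by auto
      have split: "sum g {..x} = sum g {..?y} + sum g ?W" for g :: "nat \<Rightarrow> nat"
      proof -
        have "{..x} = {..?y} \<union> ?W" using kx by auto
        then show ?thesis by (simp add: sum.union_disjoint ivl_disj_int)
      qed
      have cW: "sum c ?W = 2 * (\<Sum>i\<in>?W. c i div 2) + (\<Sum>i\<in>?W. c i mod 2)"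
        by (simp add: sum_distrib_left flip: sum.distrib)
      \<comment> \<open>Each vertex of the window carries an odd pebble, is a target, or is an even
        non-target vertex.\<close>
      have "(\<Sum>i\<in>?W. 1) \<le> (\<Sum>i\<in>?W. c i mod 2 + d i + ?ev i)"
        by (intro sum_mono) (auto simp: odd_iff_mod_2_eq_one)
      then have kW: "k \<le> (\<Sum>i\<in>?W. c i mod 2) + sum d ?W + sum ?ev ?W"
        using kx by (simp add: sum.distrib)
      have "(\<Sum>i\<in>?W. c i mod 2 + ?ev i) \<le> (\<Sum>i\<in>?W. 1)"
        by (intro sum_mono) (auto simp: odd_iff_mod_2_eq_one)
      then have ocW: "(\<Sum>i\<in>?W. c i mod 2) + sum ?ev ?W \<le> k"
        using kx by (simp add: sum.distrib)
      \<comment> \<open>Since \<open>served\<close> at \<open>x\<close> is \<open>arrived\<close> at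
        \<open>?y\<close>, this makes the queue at \<open>x\<close> twice the queue at
        \<open>?y\<close>, plus the targets and minus the pebbles of the window.\<close>
      have ax: "arrived k c d x + sum c ?W + 2 * served k c d ?y =
          arrived k c d ?y + sum d ?W + 2 * served k c d x"
        using arrived_eq[of c k d x, OF c0] arrived_eq[of c k d ?y, OF c0] split[of c] split[of d]
        by linarith
      have "4 * sum d ?W \<le> sum d ?W * 2 ^ (r + 2)"
        by simp
      moreover have "sum d {..x} * 2 ^ (r + 1 + 1) =
          2 * (sum d {..?y} * 2 ^ (r + 1)) + sum d ?W * 2 ^ (r + 2)"
        using split[of d] by (simp add: algebra_simps)
      moreover have "(r + 1) * k = r * k + k" by simp
      ultimately have
        "2 * arrived k c d x + 2 * (\<Sum>i\<le>x. c i div 2) + (r + 1) * k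
          \<le> sum d {..x} * 2 ^ (r + 1 + 1) + (Z + sum ?ev ?W) + 2 * served k c d x"
        using rZ(3,4) ax sx cW kW split[of "\<lambda>i. c i div 2"] by linarith
      moreover have "(r + 1) * k \<le> x" "Z + sum ?ev ?W \<le> (r + 1) * k"
        using rZ kx ocW by (auto simp: algebra_simps)
      ultimately show ?thesis
        using rZ(2) split[of ?ev] by (intro exI[of _ "r + 1"] exI[of _ "Z + sum ?ev ?W"]) linarith
    qed
  qed
qed

text \<open>Demands at \<open>i\<close> not yet served when \<open>y\<close> has been passed, under first in, first out.\<close>

definition pending :: "nat \<Rightarrow> (nat \<Rightarrow> nat) \<Rightarrow> (nat \<Rightarrow> nat) \<Rightarrow> nat \<Rightarrow> nat \<Rightarrow> nat" where
  "pending k c d y i =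
     (if i \<le> y then arrived k c d i - max (if i = 0 then 0 else arrived k c d (i - 1)) (served k c d y)
      else 0)"

lemma pending_beyond: "y < i \<Longrightarrow> pending k c d y i = 0"
  by (simp add: pending_def)

text \<open>The summands are the lengths of the pieces into which the intervals
  \<open>(f (i - 1), f i]\<close> cut \<open>(s, f y]\<close>. For \<open>f = arrived\<close>,
  demands are numbered by arrival and those above \<open>s\<close> are still waiting.\<close>

lemma sum_mono_increments:
  fixes f :: "nat \<Rightarrow> nat"
  assumes "mono f"
  shows "(\<Sum>i\<le>y. f i - max (if i = 0 then 0 else f (i - 1)) s) = f y - s"
proof (induction y)
  case (Suc y)
  then show ?case using monoD[OF assms, of y "Suc y"] by simp
qed simp

lemma sum_pending:
  assumes "c 0 = 0" and "y \<le> z"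
  shows "sum (pending k c d z) {..y} = arrived k c d y - served k c d z"
proof -
  have "sum (pending k c d z) {..y} =
      (\<Sum>i\<le>y. arrived k c d i - max (if i = 0 then 0 else arrived k c d (i - 1)) (served k c d z))"
    using assms(2) by (intro sum.cong) (auto simp: pending_def)
  then show ?thesis
    using sum_mono_increments[OF mono_arrived[of c k d, OF assms(1)]] by simp
qed

text \<open>When \<open>y\<close> is passed, all that arrived up to \<open>y - k\<close> has been
  served, so every waiting demand is within reach of the next vertex \<open>Suc y\<close>.\<close>

lemma pending_near:
  assumes "0 < k" and "c 0 = 0" and "0 < pending k c d y i"
  shows "i \<le> y" and "y < i + k"
proof -
  show "i \<le> y" using assms(3) by (auto simp: pending_def split: if_splits)
  have less: "served k c d y < arrived k c d i"
    using assms(3) by (auto simp: pending_def split: if_splits)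
  show "y < i + k"
  proof (rule ccontr)
    assume "\<not> y < i + k"
    then obtain x where x: "y = Suc x" "k \<le> Suc x" "i \<le> Suc x - k"
      using assms(1) by (cases y) auto
    have "arrived k c d i \<le> arrived k c d (Suc x - k)"
      using monoD[OF mono_arrived[of c k d, OF assms(2)] x(3)] .
    also have "\<dots> \<le> served k c d y"
      using served_Suc[OF assms(1), of c d x] x by simp
    finally show False using less by simp
  qed
qed

section \<open>Solving targets from the right\<close>

lemma sum_shift_interval: "sum f {a..a + x} = (\<Sum>i\<le>x. f (a + i))" for f :: "nat \<Rightarrow> nat"
  by (induction x) (auto simp: add.commute)

text \<open>The sweep is read backwards: a solution of what remains after \<open>x\<close> is
  extended one vertex at a time towards \<open>a\<close>. By \<open>backlog\<close> no vertex serves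
  more demands than are waiting.\<close>

lemma scan_sound:
  fixes n k a x :: nat and C D :: "nat \<Rightarrow> nat"
  defines "G \<equiv> path_power n k" and "c \<equiv> \<lambda>i. C (a + i)" and "d \<equiv> \<lambda>i. D (a + i)"
  assumes k: "0 < k" and a: "1 \<le> a" and x: "a + x \<le> n" and Ca: "C a = 0"
    and supp: "\<And>u. u \<notin> {a..n} \<Longrightarrow> D u = 0 \<and> C u = 0"
    and backlog: "\<And>y. y < x \<Longrightarrow> served k c d (Suc y) \<le> arrived k c d y"
    and base: "solvable G (\<lambda>v. (if a \<le> v then pending k c d x (v - a) else 0) +
        (if a + x < v then D v else 0)) (\<lambda>v. if a + x < v then C v else 0)"
  shows "solvable G D C"
proof -
  have c0: "c 0 = 0" using Ca by (simp add: c_def)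
  define tgt where "tgt = (\<lambda>y v. (if a \<le> v then pending k c d y (v - a) else 0) +
        (if a + y < v then D v else 0))"
  define cfg where "cfg = (\<lambda>y v. if a + y < v then C v else 0)"
  have "solvable G (tgt 0) (cfg 0)"
  proof (rule inc_induct[of 0 x])
    show "solvable G (tgt x) (cfg x)" using base by (simp add: tgt_def cfg_def)
  next
    fix y assume "y < x" and IH: "solvable G (tgt (Suc y)) (cfg (Suc y))"
    define w where "w = a + Suc y"
    have w: "w \<in> {1..n}" using \<open>y < x\<close> x a by (simp add: w_def)
    note bl = backlog[OF \<open>y < x\<close>]
    define j where "j = served k c d (Suc y) - served k c d y"
    have sm: "served k c d y \<le> served k c d (Suc y)" by simp
    have pend_le: "pending k c d (Suc y) i \<le> pending k c d y i" if "i \<le> y" for i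
      using sm that by (auto simp: pending_def simp del: served.simps)
    \<comment> \<open>\<open>w\<close> spends \<open>2 * j\<close> pebbles on older demands; what
      \<open>C w\<close> does not cover becomes a new demand at \<open>w\<close>.\<close>
    have pend_w: "pending k c d (Suc y) (Suc y) + C w = D w + 2 * j"
      using bl sm arrived_Suc[of c k d y, OF c0] served_step_ge[of k c d y]
      by (simp add: pending_def j_def w_def c_def d_def del: served.simps)
    define \<delta> where "\<delta> = (\<lambda>v. if a \<le> v \<and> v \<le> a + y
        then pending k c d y (v - a) - pending k c d (Suc y) (v - a) else 0)"
    have "sum \<delta> {1..n} = sum \<delta> {a..a + y}"
      using a x \<open>y < x\<close> by (intro sum.mono_neutral_right) (auto simp: \<delta>_def)
    also have "\<dots> = (\<Sum>i\<le>y. pending k c d y i - pending k c d (Suc y) i)"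
      unfolding sum_shift_interval by (intro sum.cong) (auto simp: \<delta>_def)
    also have "\<dots> = sum (pending k c d y) {..y} - sum (pending k c d (Suc y)) {..y}"
      by (rule sum_subtractf_nat) (use pend_le in auto)
    also have "\<dots> = j"
      using sum_pending[of c y y k d, OF c0] sum_pending[of c y "Suc y" k d, OF c0] bl sm
      by (simp add: j_def del: served.simps)
    finally have sum_\<delta>: "sum \<delta> (pverts G) = j" by (simp add: G_def)
    have "solvable G \<delta> (\<lambda>u. if u = w then 2 * sum \<delta> (pverts G) else 0)"
    proof (rule solvable_spread)
      fix u assume "u \<in> pverts G" "0 < \<delta> u"
      then have "a \<le> u" "u \<le> a + y" "0 < pending k c d y (u - a)" "u \<in> {1..n}"
        by (auto simp: \<delta>_def G_def split: if_splits)
      then show "(w, u) \<in> parcs G \<and> w \<noteq> u"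
        using pending_near(2)[of k c d y "u - a", OF k c0] w
        by (auto simp: G_def arc_path_power_iff w_def)
    qed (simp add: G_def)
    \<comment> \<open>\<open>T\<close> is what the service from \<open>w\<close> leaves unchanged:
      adding \<open>\<delta>\<close> gives \<open>tgt y\<close>, and adding the pebbles spent at
      \<open>w\<close> gives \<open>tgt (Suc y)\<close> together with \<open>C w\<close>.\<close>
    moreover define T where "T = (\<lambda>v. (if a \<le> v \<and> v \<le> a + y
        then pending k c d (Suc y) (v - a) else 0) + (if a + y < v then D v else 0))"
    have "solvable G T T" by (simp add: solvable_of_le)
    ultimately have "solvable G (\<lambda>u. T u + \<delta> u)
        (\<lambda>u. T u + (if u = w then 2 * sum \<delta> (pverts G) else 0))"
      using solvable_add by blast
    moreover have "(\<lambda>u. T u + \<delta> u) = tgt y"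
    proof
      fix u
      show "T u + \<delta> u = tgt y u"
        using pend_le[of "u - a"] pending_beyond[of y "u - a" k c d]
        by (cases "u \<le> a + y") (auto simp: T_def \<delta>_def tgt_def)
    qed
    moreover have "(\<lambda>u. T u + (if u = w then 2 * sum \<delta> (pverts G) else 0)) =
        (\<lambda>u. tgt (Suc y) u + (if u = w then C w else 0))"
    proof
      fix u
      consider "u < a" | "a \<le> u" "u \<le> a + y" | "u = w" | "w < u"
        unfolding w_def by linarith
      then show "T u + (if u = w then 2 * sum \<delta> (pverts G) else 0) =
          tgt (Suc y) u + (if u = w then C w else 0)"
        using pend_w sum_\<delta>
        by cases (auto simp: T_def tgt_def w_def pending_def simp del: served.simps)
    qed
    ultimately have move: "solvable G (tgt y) (\<lambda>u. tgt (Suc y) u + (if u = w then C w else 0))"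
      by simp
    have "solvable G (\<lambda>u. tgt (Suc y) u + (if u = w then C w else 0))
        (\<lambda>u. cfg (Suc y) u + (if u = w then C w else 0))"
      using IH by (rule solvable_add) (simp add: solvable_of_le)
    moreover have "(\<lambda>u. cfg (Suc y) u + (if u = w then C w else 0)) = cfg y"
      by (auto simp: fun_eq_iff cfg_def w_def)
    moreover have "tgt (Suc y) u + (if u = w then C w else 0) = 0" if "u \<notin> pverts G" for u
      using that supp[of u] w a x \<open>y < x\<close> pending_beyond[of "Suc y" "u - a" k c d]
      by (auto simp: tgt_def G_def)
    ultimately show "solvable G (tgt y) (cfg y)"
      using solvable_trans[OF _ _ move] by simp
  qed simp
  moreover have "tgt 0 = D"
    using supp by (auto simp: fun_eq_iff tgt_def pending_def arrived_def c_def d_def Ca)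
  moreover have "cfg 0 = C"
  proof
    fix u show "cfg 0 u = C u"
      using supp[of u] Ca by (cases u a rule: linorder_cases) (auto simp: cfg_def)
  qed
  ultimately show ?thesis by simp
qed

section \<open>The numerical condition on subintervals\<close>

definition pair_count :: "nat \<Rightarrow> nat \<Rightarrow> (nat \<Rightarrow> nat) \<Rightarrow> nat" where
  "pair_count a b C = (\<Sum>u=a..b. C u div 2)"

definition even_count :: "nat \<Rightarrow> nat \<Rightarrow> (nat \<Rightarrow> nat) \<Rightarrow> (nat \<Rightarrow> nat) \<Rightarrow> nat" where
  "even_count a b D C = (\<Sum>u=a..b. of_bool (D u = 0 \<and> even (C u)))"

text \<open>The inequality in terms of pairs, relative to \<open>{a..b}\<close>:
  \<open>b - a - 1\<close> is two less than the number of vertices, as \<open>n - 2\<close> is for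
  the whole path, and truncates to \<open>0\<close> if \<open>a = b\<close>.\<close>

definition rich :: "nat \<Rightarrow> nat \<Rightarrow> nat \<Rightarrow> (nat \<Rightarrow> nat) \<Rightarrow> (nat \<Rightarrow> nat) \<Rightarrow> bool" where
  "rich k a b D C \<longleftrightarrow> (\<forall>r. r * k \<le> b - a - 1 \<longrightarrow>
     sum D {a..b} * 2 ^ (r + 1) + even_count a b D C \<le> 2 * pair_count a b C + r * k + 1)"

lemma sum_split_interval:
  fixes f :: "nat \<Rightarrow> nat"
  assumes "a \<le> c" and "c \<le> b"
  shows "sum f {a..b} = sum f {a..c} + sum f {Suc c..b}"
proof -
  have "{a..b} = {a..c} \<union> {Suc c..b}" using assms by auto
  then show ?thesis by (simp add: sum.union_disjoint ivl_disj_int)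
qed

text \<open>The sweep stops before the first vertex \<open>a'\<close> whose pairs can pay the whole
  queue. Payment takes an even number of pebbles, so the parity at \<open>a'\<close> survives, and
  subtracting \<open>backlog_bound\<close> from \<open>rich\<close> leaves \<open>rich\<close> from
  \<open>a'\<close> on.\<close>

lemma peel_left:
  fixes n k a b :: nat and C D :: "nat \<Rightarrow> nat"
  assumes k: "0 < k" and a: "1 \<le> a" "a \<le> b" "b \<le> n"
    and supp: "\<And>u. u \<notin> {a..b} \<Longrightarrow> D u = 0 \<and> C u = 0"
    and CD: "\<And>u. 0 < D u \<Longrightarrow> C u = 0"
    and Da: "0 < D a" and rich: "rich k a b D C"
  obtains a' D' C' where "a < a'" "a' \<le> b"
    "\<And>u. u \<notin> {a'..b} \<Longrightarrow> D' u = 0 \<and> C' u = 0" "\<And>u. 0 < D' u \<Longrightarrow> C' u = 0"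
    "rich k a' b D' C'"
    "solvable (path_power n k) D' C' \<Longrightarrow> solvable (path_power n k) D C"
proof -
  define c where "c = (\<lambda>i. C (a + i))"
  define d where "d = (\<lambda>i. D (a + i))"
  have Ca: "C a = 0" using CD Da by simp
  have c0: "c 0 = 0" by (simp add: c_def Ca)
  have cd: "0 < d i \<Longrightarrow> c i = 0" for i using CD by (simp add: c_def d_def)
  have bound: "\<exists>r Z. r * k \<le> x \<and> Z \<le> (\<Sum>i\<le>x. of_bool (d i = 0 \<and> even (c i))) \<and> Z \<le> r * k \<and>
    2 * arrived k c d x + 2 * (\<Sum>i\<le>x. c i div 2) + r * k
      \<le> sum d {..x} * 2 ^ (r + 1) + Z + 2 * served k c d x" for x
    using backlog_bound[of k c d x, OF k c0 cd] .
  have D_split: "sum D {a..b} = sum d {..x} + sum D {Suc (a + x)..b}" if "a + x \<le> b" for x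
    using that sum_split_interval[of a "a + x" b D] sum_shift_interval[of D a x]
    by (simp add: d_def)
  have P_split: "pair_count a b C = (\<Sum>i\<le>x. c i div 2) + pair_count (Suc (a + x)) b C"
    if "a + x \<le> b" for x
    using that sum_split_interval[of a "a + x" b "\<lambda>u. C u div 2"]
      sum_shift_interval[of "\<lambda>u. C u div 2" a x]
    by (simp add: c_def pair_count_def)
  have E_split: "even_count a b D C =
      (\<Sum>i\<le>x. of_bool (d i = 0 \<and> even (c i))) + even_count (Suc (a + x)) b D C"
    if "a + x \<le> b" for x
    using that sum_split_interval[of a "a + x" b "\<lambda>u. of_bool (D u = 0 \<and> even (C u))"]
      sum_shift_interval[of "\<lambda>u. of_bool (D u = 0 \<and> even (C u))" a x]
    by (simp add: c_def d_def even_count_def)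
  \<comment> \<open>If no vertex could pay the queue, \<open>backlog_bound\<close> at
    \<open>b - 1\<close> would contradict \<open>rich\<close>; if \<open>a = b\<close>, then
    \<open>r = 0\<close> already does.\<close>
  have ex: "\<exists>x. a + Suc x \<le> b \<and> arrived k c d x \<le> served k c d x + c (Suc x) div 2"
  proof (rule ccontr)
    assume none: "\<not> ?thesis"
    show False
    proof (cases "a = b")
      case True
      then show False
        using rich Da Ca unfolding rich_def by (auto simp: pair_count_def dest!: spec[of _ 0])
    next
      case False
      define x where "x = b - a - 1"
      have x: "a + Suc x = b" using False a by (simp add: x_def)
      obtain r Z where rZ: "r * k \<le> x" "Z \<le> (\<Sum>i\<le>x. of_bool (d i = 0 \<and> even (c i)))"
        "2 * arrived k c d x + 2 * (\<Sum>i\<le>x. c i div 2) + r * k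
          \<le> sum d {..x} * 2 ^ (r + 1) + Z + 2 * served k c d x"
        using bound by blast
      have "served k c d x + c (Suc x) div 2 < arrived k c d x"
        using none x by force
      moreover have "pair_count a b C = (\<Sum>i\<le>x. c i div 2) + c (Suc x) div 2"
        using P_split[of x] x by (simp add: pair_count_def c_def)
      moreover have "sum d {..x} * 2 ^ (r + 1) \<le> sum D {a..b} * 2 ^ (r + 1)"
        using D_split[of x] x by simp
      moreover have "Z \<le> even_count a b D C"
        using E_split[of x] x rZ(2) by simp
      moreover have "sum D {a..b} * 2 ^ (r + 1) + even_count a b D C
          \<le> 2 * pair_count a b C + r * k + 1"
        using rich rZ(1) unfolding rich_def x_def by blast
      ultimately show False using rZ(3) by linarith
    qed
  qed
  define x where "x = (LEAST x. a + Suc x \<le> b \<and> arrived k c d x \<le> served k c d x + c (Suc x) div 2)"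
  have x: "a + Suc x \<le> b" "arrived k c d x \<le> served k c d x + c (Suc x) div 2"
    using LeastI_ex[OF ex] unfolding x_def by auto
  have backlog: "served k c d (Suc y) \<le> arrived k c d y" if "y < x" for y
  proof -
    \<comment> \<open>Before \<open>x\<close> the pairs fall short of the queue by at least one, so
      rounding up for an odd pebble still serves no more than is waiting.\<close>
    have "served k c d y + c (Suc y) div 2 < arrived k c d y"
      using not_less_Least[OF that[unfolded x_def]] that x(1) by auto
    moreover have "(c (Suc y) + 1) div 2 \<le> c (Suc y) div 2 + 1" by linarith
    moreover have "arrived k c d (Suc y - k) \<le> arrived k c d y"
      using monoD[OF mono_arrived[of c k d, OF c0]] k by simp
    ultimately show ?thesis using served_Suc[OF k, of c d y] by simp
  qed
  have sx: "served k c d x \<le> arrived k c d x"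
  proof (cases x)
    case (Suc y)
    then show ?thesis
      using backlog[of y] monoD[OF mono_arrived[of c k d, OF c0], of y x] by simp
  qed simp
  define Q where "Q = arrived k c d x - served k c d x"
  define a' where "a' = a + Suc x"
  define D' where "D' = (\<lambda>v. if a' \<le> v then D v else 0)"
  define C' where "C' = (\<lambda>v. if v = a' then C v - 2 * Q else if a' < v then C v else 0)"
  have Q: "2 * Q \<le> C a'"
    using x(2) by (simp add: Q_def a'_def c_def)
  show thesis
  proof
    show "a < a'" "a' \<le> b" using x by (auto simp: a'_def)
    show "\<And>u. u \<notin> {a'..b} \<Longrightarrow> D' u = 0 \<and> C' u = 0"
      using supp x(1) by (auto simp: D'_def C'_def a'_def)
    show "\<And>u. 0 < D' u \<Longrightarrow> C' u = 0"
      using CD by (auto simp: D'_def C'_def split: if_splits)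
    show "rich k a' b D' C'"
      unfolding rich_def
    proof (intro allI impI)
      fix q assume q: "q * k \<le> b - a' - 1"
      obtain r Z where rZ: "r * k \<le> x" "Z \<le> (\<Sum>i\<le>x. of_bool (d i = 0 \<and> even (c i)))"
        "2 * arrived k c d x + 2 * (\<Sum>i\<le>x. c i div 2) + r * k
          \<le> sum d {..x} * 2 ^ (r + 1) + Z + 2 * served k c d x"
        using bound by blast
      have ab: "a + x \<le> b" "Suc (a + x) = a'" using x(1) by (auto simp: a'_def)
      \<comment> \<open>\<open>rich\<close> is applied with \<open>r\<close> windows of the swept
        part and \<open>q\<close> of the rest, which fit side by side.\<close>
      have "(r + q) * k \<le> b - a - 1"
        using rZ(1) q x(1) by (simp add: a'_def algebra_simps)
      then have H: "sum D {a..b} * 2 ^ (r + q + 1) + even_count a b D C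
          \<le> 2 * pair_count a b C + (r + q) * k + 1"
        using rich unfolding rich_def by blast
      have "sum D {a'..b} = sum D' {a'..b}"
        by (intro sum.cong) (auto simp: D'_def)
      then have DD: "sum D {a..b} = sum d {..x} + sum D' {a'..b}"
        using D_split[OF ab(1)] ab(2) by simp
      have "even_count a' b D C = even_count a' b D' C'"
        unfolding even_count_def using Q by (intro sum.cong) (auto simp: D'_def C'_def)
      then have EE: "even_count a b D C =
          (\<Sum>i\<le>x. of_bool (d i = 0 \<and> even (c i))) + even_count a' b D' C'"
        using E_split[OF ab(1)] ab(2) by simp
      have "C a' div 2 = Q + (C a' - 2 * Q) div 2" using Q by linarith
      moreover have "(\<Sum>u=Suc a'..b. C u div 2) = (\<Sum>u=Suc a'..b. C' u div 2)"
        by (intro sum.cong) (auto simp: C'_def)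
      ultimately have "pair_count a' b C = Q + pair_count a' b C'"
        using x(1) by (simp add: pair_count_def sum.atLeast_Suc_atMost a'_def C'_def)
      then have PP: "pair_count a b C = (\<Sum>i\<le>x. c i div 2) + Q + pair_count a' b C'"
        using P_split[OF ab(1)] ab(2) by simp
      have "sum d {..x} * 2 ^ (r + 1) \<le> sum d {..x} * 2 ^ (r + q + 1)"
        by (intro mult_left_mono power_increasing) auto
      moreover have "sum D' {a'..b} * 2 ^ (q + 1) \<le> sum D' {a'..b} * 2 ^ (r + q + 1)"
        by (intro mult_left_mono power_increasing) auto
      moreover have "sum D {a..b} * 2 ^ (r + q + 1) =
          sum d {..x} * 2 ^ (r + q + 1) + sum D' {a'..b} * 2 ^ (r + q + 1)"
        unfolding DD by (simp add: algebra_simps)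
      moreover have "(r + q) * k = r * k + q * k" by (simp add: algebra_simps)
      moreover have "arrived k c d x = Q + served k c d x" using sx by (simp add: Q_def)
      ultimately show "sum D' {a'..b} * 2 ^ (q + 1) + even_count a' b D' C'
          \<le> 2 * pair_count a' b C' + q * k + 1"
        using H rZ(2,3) EE PP by linarith
    qed
    assume IH: "solvable (path_power n k) D' C'"
    define pd where "pd = (\<lambda>v. if a \<le> v then pending k c d x (v - a) else 0)"
    have pd_pos: "a \<le> u \<and> u \<le> a + x \<and> a' \<le> u + k" if "0 < pd u" for u
      using that pending_near[of k c d x "u - a", OF k c0]
      by (auto simp: pd_def a'_def split: if_splits)
    have "pd u = 0" if "u \<notin> {a..a + x}" for u
      using pd_pos[of u] that by auto
    then have "sum pd {1..n} = sum pd {a..a + x}"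
      using a x(1) by (intro sum.mono_neutral_right) auto
    also have "\<dots> = Q"
      unfolding sum_shift_interval using sum_pending[of c x x k d, OF c0] by (simp add: pd_def Q_def)
    finally have sum_pd: "sum pd (pverts (path_power n k)) = Q" by simp
    have "solvable (path_power n k) pd
        (\<lambda>u. if u = a' then 2 * sum pd (pverts (path_power n k)) else 0)"
    proof (rule solvable_spread)
      fix u assume "u \<in> pverts (path_power n k)" "0 < pd u"
      then show "(a', u) \<in> parcs (path_power n k) \<and> a' \<noteq> u"
        using pd_pos[of u] x(1) a by (simp add: arc_path_power_iff a'_def)
    qed simp
    from solvable_add[OF this IH]
    have "solvable (path_power n k) (\<lambda>u. pd u + D' u)
        (\<lambda>u. (if u = a' then 2 * sum pd (pverts (path_power n k)) else 0) + C' u)" .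
    moreover have "(\<lambda>u. (if u = a' then 2 * sum pd (pverts (path_power n k)) else 0) + C' u) =
        (\<lambda>v. if a + x < v then C v else 0)"
      unfolding sum_pd using Q by (auto simp: fun_eq_iff C'_def a'_def)
    moreover have "(\<lambda>u. pd u + D' u) = (\<lambda>v. (if a \<le> v then pending k c d x (v - a) else 0) +
        (if a + x < v then D v else 0))"
      by (auto simp: fun_eq_iff pd_def D'_def a'_def)
    ultimately have base: "solvable (path_power n k)
        (\<lambda>v. (if a \<le> v then pending k c d x (v - a) else 0) + (if a + x < v then D v else 0))
        (\<lambda>v. if a + x < v then C v else 0)"
      by simp
    have "a + x \<le> n" "\<And>u. u \<notin> {a..n} \<Longrightarrow> D u = 0 \<and> C u = 0"
      using x(1) a supp by auto
    then show "solvable (path_power n k) D C"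
      using scan_sound[of k a x n C D, folded c_def d_def, OF k a(1) _ Ca _ backlog base] by blast
  qed
qed

section \<open>Solvability from the pair count\<close>

text \<open>The mirror image of the path. It exchanges \<open>0\<close> and \<open>n + 1\<close> and
  fixes all larger numbers, so it is an involution on all of \<open>nat\<close> and reflecting twice
  restores functions exactly.\<close>

definition reflect :: "nat \<Rightarrow> nat \<Rightarrow> nat" where
  "reflect n u = (if u \<le> n + 1 then n + 1 - u else u)"

lemma reflect_reflect [simp]: "reflect n (reflect n u) = u"
  by (auto simp: reflect_def)

lemma pebbling_step_reflect:
  assumes "pebbling_step (path_power n k) C C'"
  shows "pebbling_step (path_power n k) (C \<circ> reflect n) (C' \<circ> reflect n)"
proof -
  obtain u v where uv: "(u, v) \<in> parcs (path_power n k)" "2 \<le> C u"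
    "C' = C(u := C u - 2, v := C v + 1)"
    using assms unfolding pebbling_step_def by blast
  have inv: "reflect n x = y \<longleftrightarrow> x = reflect n y" for x y
    by (metis reflect_reflect)
  have "C' \<circ> reflect n =
      (C \<circ> reflect n)(reflect n u := C u - 2, reflect n v := C v + 1)"
    unfolding uv(3) by (rule ext) (simp add: inv)
  moreover have "(reflect n u, reflect n v) \<in> parcs (path_power n k)"
    using uv(1) by (auto simp: arc_path_power_iff reflect_def)
  ultimately show ?thesis
    unfolding pebbling_step_def
    by (intro exI[of _ "reflect n u"] exI[of _ "reflect n v"]) (use uv(2) in simp)
qed

lemma solvable_reflect:
  assumes "solvable (path_power n k) D C"
  shows "solvable (path_power n k) (D \<circ> reflect n) (C \<circ> reflect n)"
proof -
  obtain B where B: "(pebbling_step (path_power n k))\<^sup>*\<^sup>* C B" "\<forall>v\<in>{1..n}. D v \<le> B v"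
    using assms unfolding solvable_def by auto
  from B(1) have "(pebbling_step (path_power n k))\<^sup>*\<^sup>* (C \<circ> reflect n) (B \<circ> reflect n)"
  proof induction
    case (step A B)
    then show ?case
      by (meson pebbling_step_reflect rtranclp.rtrancl_into_rtrancl)
  qed simp
  moreover have "reflect n v \<in> {1..n}" if "v \<in> {1..n}" for v
    using that by (auto simp: reflect_def)
  ultimately show ?thesis
    unfolding solvable_def using B(2) by (intro exI[of _ "B \<circ> reflect n"]) auto
qed

lemma sum_reflect:
  fixes f :: "nat \<Rightarrow> nat"
  assumes "b \<le> n"
  shows "sum (f \<circ> reflect n) {n + 1 - b..n + 1 - a} = sum f {a..b}"
  by (rule sum.reindex_bij_witness[of _ "reflect n" "reflect n"])
    (use assms in \<open>auto simp: reflect_def split: if_splits\<close>)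

lemma rich_reflect:
  assumes "rich k a b D C" and "1 \<le> a" and "a \<le> b" and "b \<le> n"
  shows "rich k (n + 1 - b) (n + 1 - a) (D \<circ> reflect n) (C \<circ> reflect n)"
proof -
  have "even_count (n + 1 - b) (n + 1 - a) (D \<circ> reflect n) (C \<circ> reflect n) = even_count a b D C"
    using sum_reflect[OF assms(4), of "\<lambda>u. of_bool (D u = 0 \<and> even (C u))" a]
    by (simp add: even_count_def comp_def)
  moreover have "pair_count (n + 1 - b) (n + 1 - a) (C \<circ> reflect n) = pair_count a b C"
    using sum_reflect[OF assms(4), of "\<lambda>u. C u div 2" a] by (simp add: pair_count_def comp_def)
  moreover have "n + 1 - a - (n + 1 - b) - 1 = b - a - 1"
    using assms by simp
  ultimately show ?thesis
    using assms(1) sum_reflect[OF assms(4), of D a] unfolding rich_def by simp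
qed

text \<open>Induction on the length of the interval: peeling, preceded by a reflection if the target
  is at the right end, and splitting both lead to strictly shorter intervals.\<close>

lemma rich_solvable:
  fixes n k a b :: nat and C D :: "nat \<Rightarrow> nat"
  assumes "0 < k" and "1 \<le> a" and "a \<le> b" and "b \<le> n"
    and "\<And>u. u \<notin> {a..b} \<Longrightarrow> D u = 0 \<and> C u = 0"
    and "\<And>u. 0 < D u \<Longrightarrow> C u = 0"
    and "rich k a b D C"
  shows "solvable (path_power n k) D C"
  using assms(2-)
proof (induction "b - a" arbitrary: a b C D rule: less_induct)
  case less
  note k = \<open>0 < k\<close> and ab = less.prems(1-3) and supp = less.prems(4) and CD = less.prems(5)
    and rich = less.prems(6)
  let ?G = "path_power n k"
  consider "0 < D a" | "0 < D b" | "D a = 0" "D b = 0" by auto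
  then show ?case
  proof cases
    case 1
    obtain a' D' C' where "a < a'" "a' \<le> b" "\<And>u. u \<notin> {a'..b} \<Longrightarrow> D' u = 0 \<and> C' u = 0"
      "\<And>u. 0 < D' u \<Longrightarrow> C' u = 0" "rich k a' b D' C'"
      "solvable ?G D' C' \<Longrightarrow> solvable ?G D C"
      using peel_left[OF k ab supp CD 1 rich] by blast
    then show ?thesis using less.hyps[of b a' D' C'] ab by auto
  next
    case 2
    let ?a = "n + 1 - b" and ?b = "n + 1 - a"
    let ?D = "D \<circ> reflect n" and ?C = "C \<circ> reflect n"
    have supp': "?D u = 0 \<and> ?C u = 0" if "u \<notin> {?a..?b}" for u
      using that ab by (auto simp: reflect_def intro!: supp[THEN conjunct1] supp[THEN conjunct2])
    have "0 < ?D ?a" using 2 ab by (simp add: reflect_def)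
    moreover have "1 \<le> ?a" "?a \<le> ?b" "?b \<le> n" using ab by auto
    moreover have CD': "\<And>u. 0 < ?D u \<Longrightarrow> ?C u = 0" using CD by simp
    ultimately obtain a' D' C' where "?a < a'" "a' \<le> ?b"
      "\<And>u. u \<notin> {a'..?b} \<Longrightarrow> D' u = 0 \<and> C' u = 0"
      "\<And>u. 0 < D' u \<Longrightarrow> C' u = 0" "rich k a' ?b D' C'"
      "solvable ?G D' C' \<Longrightarrow> solvable ?G ?D ?C"
      using peel_left[OF k _ _ _ supp' CD' _ rich_reflect[OF rich ab]] by blast
    then have "solvable ?G ?D ?C"
      using less.hyps[of ?b a' D' C'] ab by auto
    from solvable_reflect[OF this] show ?thesis
      by (simp add: comp_def)
  next
    case 3
    define seg where "seg = (\<lambda>c j u. if u < c then D u else if u = c then j else 0)"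
    define pre where "pre = (\<lambda>c u. if u \<le> c then C u else 0)"
    define good where "good = (\<lambda>c j. solvable ?G (seg c j) (pre c))"
    show ?thesis
    proof (cases "\<forall>c. good c (D c)")
      case True
      have "solvable ?G (seg b (D b)) (pre b)" using True by (simp add: good_def)
      then show ?thesis
        by (rule solvable_mono) (use supp in \<open>auto simp: seg_def pre_def\<close>)
    next
      case False
      \<comment> \<open>The first vertex whose full demand the pebbles up to it cannot meet along
        with the earlier targets. Below, \<open>j\<close> of its units are met from the left and
        \<open>D c - j\<close> from the right.\<close>
      define c where "c = (LEAST c. \<not> good c (D c))"
      have nc: "\<not> good c (D c)"
        using False unfolding c_def by (metis (mono_tags, lifting) LeastI)
      have "good c 0"
      proof (cases c)
        case 0
        then show ?thesis by (simp add: good_def seg_def solvable_of_le)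
      next
        case (Suc c')
        then have "solvable ?G (seg c' (D c')) (pre c')"
          using not_less_Least[of c' "\<lambda>c. \<not> good c (D c)"] unfolding c_def[symmetric]
          by (simp add: good_def)
        then show ?thesis
          unfolding good_def by (rule solvable_mono) (auto simp: seg_def pre_def Suc)
      qed
      then obtain j where j: "j < D c" "good c j" "\<not> good c (Suc j)"
        using nc dec_induct[of 0 "D c" "good c"] by blast
      have c: "a < c" "c < b"
        using j(1) 3 supp[of c] by (cases c a rule: linorder_cases; cases c b rule: linorder_cases; auto)+
      have Cc: "C c = 0" using CD j(1) by auto
      define D1 where "D1 = seg c (Suc j)"
      define D2 where "D2 = (\<lambda>u. if u = c then D c - j else if c < u then D u else 0)"
      define post where "post = (\<lambda>u. if c < u then C u else 0)"
      have "\<not> rich k a c D1 (pre c)"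
      proof
        assume "rich k a c D1 (pre c)"
        moreover have "D1 u = 0 \<and> pre c u = 0" if "u \<notin> {a..c}" for u
          using that supp[of u] c by (auto simp: D1_def seg_def pre_def)
        moreover have "0 < D1 u \<Longrightarrow> pre c u = 0" for u
          using CD[of u] Cc by (auto simp: D1_def seg_def pre_def split: if_splits)
        ultimately have "solvable ?G D1 (pre c)"
          using less.hyps[of c a D1 "pre c"] c ab by auto
        then show False using j(3) by (simp add: good_def D1_def)
      qed
      then obtain r where r: "r * k \<le> c - a - 1"
        "2 * pair_count a c (pre c) + r * k + 1 < sum D1 {a..c} * 2 ^ (r + 1) + even_count a c D1 (pre c)"
        unfolding rich_def by (auto simp: not_le)
      \<comment> \<open>The unit that separates \<open>j\<close> from \<open>Suc j\<close> is
        counted on both sides, hence the surplus \<open>1\<close>.\<close>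
      have sums: "sum D1 {a..c} + sum D2 {c..b} = sum D {a..b} + 1"
        "1 \<le> sum D1 {a..c}" "1 \<le> sum D2 {c..b}"
      proof -
        have "sum D1 {a..c} = sum D {a..<c} + Suc j"
          using c by (simp add: sum.last_plus D1_def seg_def)
        moreover have "sum D2 {c..b} = D c - j + sum D {Suc c..b}"
          using c by (simp add: sum.atLeast_Suc_atMost D2_def)
        moreover have "sum D {a..b} = sum D {a..<c} + D c + sum D {Suc c..b}"
          using c sum_split_interval[of a c b D] by (simp add: sum.last_plus)
        ultimately show "sum D1 {a..c} + sum D2 {c..b} = sum D {a..b} + 1"
          "1 \<le> sum D1 {a..c}" "1 \<le> sum D2 {c..b}"
          using j(1) by auto
      qed
      have pairs: "pair_count a b C = pair_count a c (pre c) + pair_count c b post"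
      proof -
        have "pair_count a c (pre c) = (\<Sum>u=a..c. C u div 2)"
          unfolding pair_count_def by (intro sum.cong) (auto simp: pre_def)
        moreover have "pair_count c b post = (\<Sum>u=Suc c..b. C u div 2)"
          using c by (simp add: pair_count_def post_def sum.atLeast_Suc_atMost)
        ultimately show ?thesis
          using c sum_split_interval[of a c b "\<lambda>u. C u div 2"] by (simp add: pair_count_def)
      qed
      have evens: "even_count a b D C = even_count a c D1 (pre c) + even_count c b D2 post"
      proof -
        have "even_count a c D1 (pre c) = (\<Sum>u=a..c. of_bool (D u = 0 \<and> even (C u)))"
          unfolding even_count_def using j(1)
          by (intro sum.cong) (auto simp: pre_def D1_def seg_def)
        moreover have "even_count c b D2 post = (\<Sum>u=Suc c..b. of_bool (D u = 0 \<and> even (C u)))"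
        proof -
          have "even_count c b D2 post =
              of_bool (D2 c = 0 \<and> even (post c)) + (\<Sum>u=Suc c..b. of_bool (D2 u = 0 \<and> even (post u)))"
            unfolding even_count_def using c by (intro sum.atLeast_Suc_atMost) simp
          also have "(\<Sum>u=Suc c..b. of_bool (D2 u = 0 \<and> even (post u))) =
              (\<Sum>u=Suc c..b. of_bool (D u = 0 \<and> even (C u)))"
            by (intro sum.cong) (auto simp: D2_def post_def)
          finally show ?thesis using j(1) by (simp add: D2_def)
        qed
        ultimately show ?thesis
          using c sum_split_interval[of a c b "\<lambda>u. of_bool (D u = 0 \<and> even (C u))"]
          by (simp add: even_count_def)
      qed
      have "rich k c b D2 post"
        unfolding rich_def
      proof (intro allI impI)
        fix q assume q: "q * k \<le> b - c - 1"
        have "(r + q) * k \<le> b - a - 1"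
          using r(1) q c by (simp add: algebra_simps)
        then have H: "sum D {a..b} * 2 ^ (r + q + 1) + even_count a b D C
            \<le> 2 * pair_count a b C + (r + q) * k + 1"
          using rich unfolding rich_def by blast
        obtain x y where xy: "sum D1 {a..c} = Suc x" "sum D2 {c..b} = Suc y"
          using sums(2,3) by (metis Suc_le_D One_nat_def)
        have "sum D {a..b} = Suc (x + y)" using sums(1) xy by simp
        moreover define A B :: nat where "A = 2 ^ r" and "B = 2 ^ q"
        have "1 \<le> A" "1 \<le> B" by (auto simp: A_def B_def)
        then obtain A' B' where AB: "A = Suc A'" "B = Suc B'"
          by (metis Suc_le_D One_nat_def)
        \<comment> \<open>After doubling, the error is \<open>2\<close>. It is offset by the failure
          on the left, where the demand side exceeds
          \<open>2 * pair_count a c (pre c) + r * k\<close> by at least \<open>2\<close>.\<close>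
        have "Suc x * A + Suc y * B \<le> Suc (x + y) * (A * B) + 1"
          unfolding AB by (simp add: algebra_simps)
        ultimately have "sum D1 {a..c} * 2 ^ (r + 1) + sum D2 {c..b} * 2 ^ (q + 1)
            \<le> sum D {a..b} * 2 ^ (r + q + 1) + 2"
          unfolding xy by (simp add: A_def B_def power_add algebra_simps)
        moreover have "(r + q) * k = r * k + q * k" by (simp add: algebra_simps)
        ultimately show "sum D2 {c..b} * 2 ^ (q + 1) + even_count c b D2 post
            \<le> 2 * pair_count c b post + q * k + 1"
          using H r(2) pairs evens by linarith
      qed
      moreover have "D2 u = 0 \<and> post u = 0" if "u \<notin> {c..b}" for u
        using that supp[of u] c by (auto simp: D2_def post_def)
      moreover have "0 < D2 u \<Longrightarrow> post u = 0" for u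
        using CD[of u] by (auto simp: D2_def post_def split: if_splits)
      ultimately have "solvable ?G D2 post"
        using less.hyps[of b c D2 post] c ab by auto
      with j(2) have "solvable ?G (\<lambda>u. seg c j u + D2 u) (\<lambda>u. pre c u + post u)"
        unfolding good_def by (rule solvable_add)
      then show ?thesis
        by (rule solvable_mono) (use j(1) in \<open>auto simp: seg_def D2_def pre_def post_def\<close>)
    qed
  qed
qed

section \<open>Arithmetic of the size bound\<close>

lemma pp_d_Suc: "pp_d n k = Suc ((n - 2) div k)"
  by (simp add: pp_d_def)

lemma pp_bound_eq:
  "pp_bound t n k =
     max (t * 2 ^ Suc ((n - 2) div k) + (n - 2 - k * ((n - 2) div k))) (2 * t + (n - 2))"
  by (simp add: pp_bound_def pp_b_def pp_d_Suc)

text \<open>Each doubling up to \<open>r\<close> adds at most \<open>t * 2 ^ r\<close>, hence at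
  most \<open>k\<close>; in \<open>doublings_large\<close> each later one adds at least
  \<open>k\<close>. Together they express convexity in \<open>r\<close>.\<close>

lemma doublings_small: "t * 2 ^ r \<le> k \<Longrightarrow> t * 2 ^ Suc r \<le> 2 * t + r * k" for t r k :: nat
  by (induction r) auto

lemma doublings_large: "k \<le> t * 2 ^ r \<Longrightarrow> t * 2 ^ Suc r + i * k \<le> t * 2 ^ Suc (r + i)"
  for t r k i :: nat
proof (induction i)
  case (Suc i)
  have "t * 2 ^ r \<le> t * 2 ^ Suc (r + i)"
    by (intro mult_left_mono power_increasing) auto
  then show ?case using Suc by simp
qed simp

text \<open>The left side minus \<open>r * k\<close> is convex in \<open>r\<close>, so it is largest at one of the endpoints
  \<open>r = 0\<close> and \<open>r = (n - 2) div k\<close>, which give the two terms of the maximum.\<close>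

lemma pp_bound_convex:
  fixes n k r t :: nat
  assumes "2 \<le> n" and "1 \<le> k" and "r * k \<le> n - 2"
  shows "t * 2 ^ (r + 1) + n \<le> pp_bound t n k + r * k + 2"
proof (cases "t * 2 ^ r \<le> k")
  case True
  then show ?thesis
    using doublings_small[OF True] assms by (simp add: pp_bound_eq)
next
  case False
  define m where "m = (n - 2) div k"
  have "r \<le> m" using assms by (simp add: m_def less_eq_div_iff_mult_less_eq)
  then obtain i where i: "m = r + i" using le_Suc_ex by blast
  have "k * m \<le> n - 2" by (simp add: m_def)
  moreover have "t * 2 ^ Suc r + i * k \<le> t * 2 ^ Suc m"
    using doublings_large[of k t r i] False i by simp
  moreover have "t * 2 ^ Suc m + (n - 2 - k * m) \<le> pp_bound t n k"
    by (simp add: pp_bound_eq m_def)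
  moreover have "k * m = r * k + i * k" by (simp add: i algebra_simps)
  ultimately show ?thesis using assms(1) by simp
qed

text \<open>Matching a pebble with a target under it uses up one pebble and possibly one vertex of
  the support, so the bound must drop by two per unit of demand.\<close>

lemma pp_bound_Suc: "pp_bound t n k + 2 \<le> pp_bound (Suc t) n k"
proof -
  define X where "X = (2::nat) ^ Suc ((n - 2) div k)"
  have "2 \<le> X" by (simp add: X_def)
  then show ?thesis
    unfolding pp_bound_eq X_def[symmetric] by (auto simp: max_def)
qed

lemma sum_pairs: "sum C A = 2 * (\<Sum>u\<in>A. C u div 2) + (\<Sum>u\<in>A. C u mod 2)" for C :: "'a \<Rightarrow> nat"
  by (simp add: sum_distrib_left flip: sum.distrib)

lemma solvable_of_size:
  fixes n k t :: nat and C D :: "nat \<Rightarrow> nat"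
  assumes n: "2 \<le> n" and k: "1 \<le> k" and "sum D {1..n} = t"
    and "pp_bound t n k + 1 \<le> sum C {1..n} + card {v \<in> {1..n}. 0 < D v}"
  shows "solvable (path_power n k) D C"
  using assms(3,4)
proof (induction t arbitrary: C D rule: less_induct)
  case (less t)
  note t = less.prems(1) and size = less.prems(2)
  show ?case
  proof (cases "\<exists>v\<in>{1..n}. 0 < C v \<and> 0 < D v")
    case True
    then obtain v where v: "v \<in> {1..n}" "0 < C v" "0 < D v" by blast
    let ?e = "\<lambda>u. if u = v then 1 else 0 :: nat"
    let ?C = "\<lambda>u. C u - ?e u" and ?D = "\<lambda>u. D u - ?e u"
    have D: "sum D {1..n} = Suc (sum ?D {1..n})" and C: "sum C {1..n} = Suc (sum ?C {1..n})"
      using v by (simp_all add: sum.remove[of _ v])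
    have "card {u \<in> {1..n}. 0 < D u} \<le> card (insert v {u \<in> {1..n}. 0 < ?D u})"
      by (intro card_mono) auto
    also have "\<dots> \<le> Suc (card {u \<in> {1..n}. 0 < ?D u})"
      by (rule card_insert_le_m1) auto
    finally have "pp_bound (sum ?D {1..n}) n k + 1 \<le> sum ?C {1..n} + card {u \<in> {1..n}. 0 < ?D u}"
      using size C pp_bound_Suc[of "sum ?D {1..n}" n k] D t by simp
    then have "solvable (path_power n k) ?D ?C"
      using less.IH[of "sum ?D {1..n}" ?D ?C] D t by simp
    from solvable_add[OF this solvable_of_le[of _ ?e ?e]]
    have "solvable (path_power n k) (\<lambda>u. ?D u + ?e u) (\<lambda>u. ?C u + ?e u)" by simp
    moreover have "(\<lambda>u. ?D u + ?e u) = D" "(\<lambda>u. ?C u + ?e u) = C"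
      using v by auto
    ultimately show ?thesis by simp
  next
    case False
    define C0 where "C0 = (\<lambda>u. if u \<in> {1..n} then C u else 0)"
    define D0 where "D0 = (\<lambda>u. if u \<in> {1..n} then D u else 0)"
    \<comment> \<open>Exactly one of three holds at each vertex: odd, even non-target, target.
      Summation turns the size hypothesis into one on pairs and even vertices.\<close>
    have "C0 u mod 2 + of_bool (D0 u = 0 \<and> even (C0 u)) + of_bool (0 < D u) = 1"
      if "u \<in> {1..n}" for u
    proof -
      have "C u = 0 \<or> D u = 0" using False that by auto
      then show ?thesis
        using that by (auto simp: C0_def D0_def odd_iff_mod_2_eq_one)
    qed
    then have "(\<Sum>u=1..n. C0 u mod 2 + of_bool (D0 u = 0 \<and> even (C0 u)) + of_bool (0 < D u)) =
        (\<Sum>u=1..n. 1)"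
      by (rule sum.cong[OF refl])
    moreover have "(\<Sum>u=1..n. of_bool (0 < D u)) = card {v \<in> {1..n}. 0 < D v}"
      by (simp add: Int_def)
    ultimately have count:
      "(\<Sum>u=1..n. C0 u mod 2) + even_count 1 n D0 C0 + card {v \<in> {1..n}. 0 < D v} = n"
      by (simp add: sum.distrib even_count_def)
    have "sum C {1..n} = sum C0 {1..n}" and D0: "sum D0 {1..n} = t"
      using t by (auto simp: C0_def D0_def)
    then have C0: "sum C {1..n} = 2 * pair_count 1 n C0 + (\<Sum>u=1..n. C0 u mod 2)"
      using sum_pairs[of C0 "{1..n}"] by (simp add: pair_count_def)
    have "rich k 1 n D0 C0"
      unfolding rich_def
    proof (intro allI impI)
      fix r assume "r * k \<le> n - 1 - 1"
      then show "sum D0 {1..n} * 2 ^ (r + 1) + even_count 1 n D0 C0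
          \<le> 2 * pair_count 1 n C0 + r * k + 1"
        using pp_bound_convex[OF n k, of r t] size count C0 D0 by (simp add: numeral_2_eq_2)
    qed
    then have "solvable (path_power n k) D0 C0"
      using False n k by (intro rich_solvable[of k 1 n n]) (auto simp: C0_def D0_def)
    then show ?thesis
      by (rule solvable_mono) (auto simp: C0_def D0_def)
  qed
qed

section \<open>Potential and small targets\<close>

text \<open>Taking two pebbles off \<open>u\<close> lowers its term by at least one, even if both
  are surplus, and the new pebble raises the term of \<open>v\<close> by at most one.\<close>

lemma potential_step:
  assumes "pair_graph G" and "pebbling_step G C C'"
  shows "potential G D C' \<le> potential G D C"
proof -
  interpret pair_graph G by fact
  define \<phi> where "\<phi> = (\<lambda>v c. min c (D v) + (c - D v) div 2)"
  obtain u v where uv: "(u, v) \<in> parcs G" "2 \<le> C u" "C' = C(u := C u - 2, v := C v + 1)"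
    using assms(2) unfolding pebbling_step_def by blast
  have ne: "u \<noteq> v" and inV: "u \<in> pverts G" "v \<in> pverts G"
    using uv(1) no_loops' in_arcsD1 in_arcsD2 by auto
  have split: "potential G D B = \<phi> u (B u) + \<phi> v (B v) + (\<Sum>w\<in>pverts G - {u} - {v}. \<phi> w (B w))" for B
    using ne inV unfolding potential_def \<phi>_def
    by (simp add: sum.remove[of "pverts G" u] sum.remove[of "pverts G - {u}" v])
  have "(\<Sum>w\<in>pverts G - {u} - {v}. \<phi> w (C' w)) = (\<Sum>w\<in>pverts G - {u} - {v}. \<phi> w (C w))"
    using uv(3) by (intro sum.cong) auto
  moreover have "\<phi> u (C u - 2) + 1 \<le> \<phi> u (C u)"
    using uv(2) unfolding \<phi>_def by linarith
  moreover have "\<phi> v (C v + 1) \<le> \<phi> v (C v) + 1"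
    unfolding \<phi>_def by linarith
  ultimately show ?thesis
    unfolding split using uv(3) ne by simp
qed

text \<open>A configuration meeting \<open>D\<close> has at least this potential, and moves never
  raise it. A potential of \<open>dist_size G D - 1\<close> thus certifies unsolvability.\<close>

lemma dist_size_le_potential:
  assumes "pair_graph G" and "solvable G D C"
  shows "dist_size G D \<le> potential G D C"
proof -
  obtain B where B: "(pebbling_step G)\<^sup>*\<^sup>* C B" "\<forall>v\<in>pverts G. D v \<le> B v"
    using assms(2) unfolding solvable_def by blast
  have "dist_size G D \<le> potential G D B"
    unfolding dist_size_def potential_def using B(2) by (intro sum_mono) auto
  also from B(1) have "potential G D B \<le> potential G D C"
    by induction (auto intro: order_trans potential_step[OF assms(1)])
  finally show ?thesis .
qed

lemma dist_support_le_size: "finite (pverts G) \<Longrightarrow> dist_support G D \<le> dist_size G D"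
proof -
  assume fin: "finite (pverts G)"
  have "dist_support G D = (\<Sum>v\<in>pverts G. of_bool (0 < D v))"
    using fin by (simp add: dist_support_def Int_def)
  also have "\<dots> \<le> dist_size G D"
    unfolding dist_size_def by (intro sum_mono) auto
  finally show ?thesis .
qed

lemma pp_t0_eq:
  "(n - 2) div k \<noteq> 0 \<Longrightarrow>
     pp_t0 n k = real k * real ((n - 2) div k) / (2 ^ Suc ((n - 2) div k) - 2)"
  by (simp add: pp_t0_def pp_d_Suc)

lemma two_less_power: "m \<noteq> 0 \<Longrightarrow> (2::real) < 2 ^ Suc m"
  using power_strict_increasing[of 1 "Suc m" "2::real"] by simp

text \<open>For \<open>d \<ge> 2\<close>, clearing denominators gives
  \<open>t * (2 ^ d - 2) \<le> k * (d - 1)\<close>, so the linear term wins the maximum;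
  \<open>2 ^ d \<ge> 4\<close> then yields \<open>2 * t \<le> n - 2\<close>. The bound
  \<open>t < n\<close> provides a non-target vertex for the extremal configuration.\<close>

lemma wide_bounds:
  assumes "2 \<le> n" and "wide t n k"
  shows "t < n" and "pp_bound t n k = 2 * t + (n - 2)"
proof -
  define m where "m = (n - 2) div k"
  have km: "k * m \<le> n - 2" by (simp add: m_def)
  have "t < n \<and> t * 2 ^ Suc m + (n - 2 - k * m) \<le> 2 * t + (n - 2)"
  proof (cases "m = 0")
    case True
    then have "t \<le> 1"
      using assms by (simp add: wide_def pp_t0_def pp_d_Suc m_def)
    then show ?thesis using True assms(1) by simp
  next
    case False
    have "real t * (2 ^ Suc m - 2) \<le> real k * real m"
      using assms(2) pp_t0_eq[of n k] False two_less_power[OF False]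
      unfolding wide_def m_def by (simp add: pos_le_divide_eq)
    then have "real (t * 2 ^ Suc m) \<le> real (2 * t + k * m)"
      by (simp add: algebra_simps)
    then have *: "t * 2 ^ Suc m \<le> 2 * t + k * m"
      using of_nat_le_iff by blast
    have "t * 4 \<le> t * 2 ^ Suc m"
      using False power_increasing[of 2 "Suc m" "2::nat"] by (intro mult_left_mono) auto
    with * have "2 * t \<le> k * m" by linarith
    then show ?thesis using * km assms(1) by linarith
  qed
  then show "t < n" "pp_bound t n k = 2 * t + (n - 2)"
    by (simp_all add: pp_bound_eq m_def)
qed

lemma small_path_power:
  fixes n k t :: nat and D :: "nat \<Rightarrow> nat"
  defines "G \<equiv> path_power n k"
  assumes n: "2 \<le> n" and k: "1 \<le> k" and t: "1 \<le> t" "dist_size G D = t" and wide: "wide t n k"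
    and upper: "\<And>C. pp_bound t n k + 1 \<le> dist_size G C + dist_support G D \<Longrightarrow> solvable G D C"
  shows "small G D"
proof -
  have V: "pverts G = {1..n}" by (simp add: G_def)
  define S where "S = {v \<in> {1..n}. 0 < D v}"
  have s: "dist_support G D = card S" by (simp add: dist_support_def V S_def)
  have "card S \<le> t" using dist_support_le_size[of G D] s t(2) V by simp
  then have "card S < n" using wide_bounds(1)[OF n wide] by simp
  then have "S \<noteq> {1..n}" by auto
  then obtain w where w: "w \<in> {1..n}" "D w = 0" unfolding S_def by blast
  \<comment> \<open>The only pairs are the \<open>t - 1\<close> on \<open>w\<close>, so the
    potential is \<open>t - 1\<close>, while the size \<open>2 * t + (n - 2) - card S\<close> is one
    below the upper bound.\<close>
  define C where "C = (\<lambda>u. if u = w then 2 * t - 1 else of_bool (D u = 0))"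
  have "(\<Sum>u\<in>{1..n} - {w}. of_bool (D u = 0) + of_bool (0 < D u)) = (\<Sum>u\<in>{1..n} - {w}. 1::nat)"
    by (intro sum.cong) auto
  moreover have "(\<Sum>u\<in>{1..n} - {w}. of_bool (0 < D u)) = card S"
    using w by (simp add: S_def) (rule arg_cong[of _ _ card], auto)
  ultimately have "(\<Sum>u\<in>{1..n} - {w}. of_bool (D u = 0)) + card S = n - 1"
    using w by (simp add: sum.distrib)
  moreover have "sum C ({1..n} - {w}) = (\<Sum>u\<in>{1..n} - {w}. of_bool (D u = 0))"
    by (intro sum.cong) (auto simp: C_def)
  moreover have "sum C {1..n} = C w + sum C ({1..n} - {w})"
    using w by (simp add: sum.remove)
  ultimately have size: "dist_size G C + card S = pp_bound t n k"
    using wide_bounds(2)[OF n wide] n t(1) by (simp add: dist_size_def V C_def)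
  have "potential G D C = (\<Sum>u\<in>{1..n}. if u = w then t - 1 else 0)"
    unfolding potential_def V using w t(1) by (intro sum.cong) (auto simp: C_def)
  then have pot: "potential G D C + 1 = dist_size G D"
    using w t by simp
  then have unsolvable: "\<not> solvable G D C"
    using dist_size_le_potential[of G D C] pair_graph_path_power[of n k] G_def by auto
  have sol: "\<forall>C'. dist_size G C + 1 \<le> dist_size G C' \<longrightarrow> solvable G D C'"
    using upper size s by auto
  have "pebbling_number G D = dist_size G C + 1"
    unfolding pebbling_number_def
  proof (rule Least_equality)
    show "\<forall>C'. dist_size G C + 1 \<le> dist_size G C' \<longrightarrow> solvable G D C'" by (rule sol)
  next
    fix m assume "\<forall>C'. m \<le> dist_size G C' \<longrightarrow> solvable G D C'"
    then show "dist_size G C + 1 \<le> m" using unsolvable by (metis Suc_eq_plus1 not_less_eq_eq)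
  qed
  then show ?thesis
    unfolding small_def using unsolvable pot by auto
qed

section \<open>Cheap solutions of a single target\<close>

lemma split_sum:
  fixes f :: "'a \<Rightarrow> nat"
  assumes "finite A" and "p \<le> sum f A"
  shows "\<exists>g. (\<forall>u. g u \<le> f u) \<and> sum g A = p"
  using assms(2)
proof (induction p)
  case 0
  show ?case by (rule exI[of _ "\<lambda>_. 0"]) simp
next
  case (Suc p)
  then obtain g where g: "\<forall>u. g u \<le> f u" "sum g A = p" by auto
  obtain u where u: "u \<in> A" "g u < f u"
  proof (rule ccontr)
    assume "\<not> thesis"
    then have "sum f A \<le> sum g A" using that by (intro sum_mono) (meson not_le)
    then show False using g(2) Suc.prems by simp
  qed
  have "sum (g(u := Suc (g u))) A = Suc (sum g A)"
    using assms(1) u by (simp add: sum.remove[of A u])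
  then show ?case
    using g u by (intro exI[of _ "g(u := Suc (g u))"]) auto
qed

text \<open>Either some pair is adjacent to \<open>v\<close>, or all pairs lie beyond the vertex at distance \<open>k\<close> from
  \<open>v\<close>; then half of the pairs suffice to put a pebble there, and doing so twice yields one on \<open>v\<close>.\<close>

lemma one_sided_cost:
  fixes n k v e :: nat and f C :: "nat \<Rightarrow> nat" and right :: bool
  assumes "v \<in> {1..n}" and "\<And>u. 2 * f u \<le> C u"
    and "\<And>u. 0 < f u \<Longrightarrow> u \<in> {1..n} \<and>
      (if right then v < u \<and> u \<le> v + k * Suc e else u < v \<and> v \<le> u + k * Suc e)"
    and "2 ^ e \<le> sum f {1..n}"
  shows "solves_with_cost_at_most (path_power n k) C v (2 ^ Suc e)"
  using assms
proof (induction e arbitrary: v f C)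
  case 0
  then have "\<exists>u\<in>{1..n}. 0 < f u"
    by (metis gr0I not_one_le_zero power_0 sum.neutral)
  then obtain u where u: "u \<in> {1..n}" "0 < f u" by blast
  define C' where "C' = C(u := C u - 2, v := C v + 1)"
  have "(u, v) \<in> parcs (path_power n k)" "2 \<le> C u"
    using u 0(1) 0(2)[of u] 0(3)[of u] by (auto simp: arc_path_power_iff split: if_splits)
  then have "pebbling_step (path_power n k) C C'"
    unfolding pebbling_step_def C'_def by blast
  then show ?case
    unfolding solves_with_cost_at_most_def
    by (intro exI[of _ 1] exI[of _ C']) (auto simp: C'_def OO_def)
next
  case (Suc e)
  let ?G = "path_power n k"
  show ?case
  proof (cases "\<exists>u. 0 < f u \<and> (u, v) \<in> parcs ?G")
    case True
    then obtain u where u: "0 < f u" "(u, v) \<in> parcs ?G" by blast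
    define C' where "C' = C(u := C u - 2, v := C v + 1)"
    have "2 \<le> C u" using u(1) Suc.prems(2)[of u] by simp
    then have "pebbling_step ?G C C'"
      unfolding pebbling_step_def C'_def using u(2) by blast
    then have "(pebbling_step ?G ^^ 1) C C'" by (auto simp: OO_def)
    moreover have "1 + 1 \<le> (2::nat) ^ Suc (Suc e)"
      unfolding one_add_one by (rule self_le_power) auto
    moreover have "1 \<le> C' v" by (simp add: C'_def)
    ultimately show ?thesis
      unfolding solves_with_cost_at_most_def by blast
  next
    case False
    define v' where "v' = (if right then v + k else v - k)"
    have far: "u \<in> {1..n} \<and> (if right then v' < u \<and> u \<le> v' + k * Suc e
        else u < v' \<and> v' \<le> u + k * Suc e) \<and> (\<not> right \<longrightarrow> u + k < v)" if "0 < f u" for u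
    proof -
      have "(u, v) \<notin> parcs ?G" using False that by blast
      then show ?thesis
        using Suc.prems(1) Suc.prems(3)[OF that]
        by (auto simp: arc_path_power_iff v'_def split: if_splits)
    qed
    have "0 < sum f {1..n}" using Suc.prems(4) by (metis less_le_trans pos2 zero_less_power)
    then obtain u where u: "0 < f u"
      by (metis gr0I less_numeral_extra(3) sum.neutral)
    have k: "0 < k"
    proof (rule ccontr)
      assume "\<not> 0 < k"
      then show False using Suc.prems(3)[OF u] by (auto split: if_splits)
    qed
    have v': "v' \<in> {1..n}" and arc: "(v', v) \<in> parcs ?G"
      using far[OF u] Suc.prems(1) k by (auto simp: v'_def arc_path_power_iff split: if_splits)
    \<comment> \<open>The pairs are divided into two lots of at least \<open>2 ^ e\<close>, one for
      each pebble wanted on \<open>v'\<close>; all other pebbles stay idle in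
      \<open>K\<close>.\<close>
    have "2 ^ e \<le> sum f {1..n}" using Suc.prems(4) by simp
    then obtain f1 where f1: "\<forall>u. f1 u \<le> f u" "sum f1 {1..n} = 2 ^ e"
      using split_sum[of "{1..n}" "2 ^ e" f] by auto
    define f2 where "f2 = (\<lambda>u. f u - f1 u)"
    have f2: "2 ^ e \<le> sum f2 {1..n}"
      using f1 Suc.prems(4) by (simp add: f2_def sum_subtractf_nat)
    have "solves_with_cost_at_most ?G (\<lambda>u. 2 * f1 u) v' (2 ^ Suc e)"
      using f1 far by (intro Suc.IH[OF v', of f1]) (auto dest: order.strict_trans2)
    then obtain c1 C1 where C1: "(pebbling_step ?G ^^ c1) (\<lambda>u. 2 * f1 u) C1" "1 \<le> C1 v'"
      "c1 + 1 \<le> 2 ^ Suc e"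
      unfolding solves_with_cost_at_most_def by blast
    have "solves_with_cost_at_most ?G (\<lambda>u. 2 * f2 u) v' (2 ^ Suc e)"
      using f2 far by (intro Suc.IH[OF v', of f2]) (auto simp: f2_def)
    then obtain c2 C2 where C2: "(pebbling_step ?G ^^ c2) (\<lambda>u. 2 * f2 u) C2" "1 \<le> C2 v'"
      "c2 + 1 \<le> 2 ^ Suc e"
      unfolding solves_with_cost_at_most_def by blast
    define K where "K = (\<lambda>u. C u - 2 * f u)"
    have C: "C = (\<lambda>u. 2 * f1 u + (2 * f2 u + K u))"
    proof
      fix u
      have "2 * f u \<le> C u" "f1 u \<le> f u" using Suc.prems(2) f1(1) by auto
      then show "C u = 2 * f1 u + (2 * f2 u + K u)" by (simp add: K_def f2_def)
    qed
    have "(pebbling_step ?G ^^ c1) C (\<lambda>u. C1 u + (2 * f2 u + K u))"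
      unfolding C by (rule pebbling_steps_add[OF C1(1)])
    moreover have "(pebbling_step ?G ^^ c2) (\<lambda>u. C1 u + (2 * f2 u + K u)) (\<lambda>u. C2 u + (C1 u + K u))"
      using pebbling_steps_add[OF C2(1), of "\<lambda>u. C1 u + K u"] by (simp add: ac_simps)
    ultimately have "(pebbling_step ?G ^^ (c1 + c2)) C (\<lambda>u. C2 u + (C1 u + K u))"
      by (rule relpowp_trans)
    moreover define C' where
      "C' = (\<lambda>u. C2 u + (C1 u + K u))
        (v' := C2 v' + (C1 v' + K v') - 2, v := C2 v + (C1 v + K v) + 1)"
    have "pebbling_step ?G (\<lambda>u. C2 u + (C1 u + K u)) C'"
      unfolding pebbling_step_def C'_def using arc C1(2) C2(2)
      by (intro exI[of _ v'] exI[of _ v]) simp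
    ultimately have "(pebbling_step ?G ^^ Suc (c1 + c2)) C C'"
      using relcomppI by simp
    moreover have "1 \<le> C' v" by (simp add: C'_def)
    \<comment> \<open>The \<open>+ 1\<close> in the cost makes costs additive:
      \<open>(c1 + 1) + (c2 + 1)\<close> already includes the final step from \<open>v'\<close> to
      \<open>v\<close>.\<close>
    moreover have "Suc (c1 + c2) + 1 \<le> 2 ^ Suc (Suc e)"
      using C1(3) C2(3) by simp
    ultimately show ?thesis
      unfolding solves_with_cost_at_most_def by blast
  qed
qed

section \<open>Distances, and the choice of a side\<close>

lemma relpow_path_power_bound:
  "(u, v) \<in> parcs (path_power n k) ^^ m \<Longrightarrow> u \<le> v + k * m \<and> v \<le> u + k * m"
proof (induction m arbitrary: v)
  case (Suc m)
  then obtain w where "(u, w) \<in> parcs (path_power n k) ^^ m" "(w, v) \<in> parcs (path_power n k)"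
    by auto
  then show ?case using Suc.IH[of w] by (auto simp: arc_path_power_iff)
qed auto

text \<open>Needed so that the \<open>LEAST\<close> in \<open>graph_dist\<close> is attained by an
  actual walk.\<close>

lemma path_power_connected:
  assumes "1 \<le> k" and "u \<in> {1..n}" and "v \<in> {1..n}"
  shows "(u, v) \<in> (parcs (path_power n k))\<^sup>*"
proof -
  have "(x, y) \<in> (parcs (path_power n k))\<^sup>* \<and> (y, x) \<in> (parcs (path_power n k))\<^sup>*"
    if "x \<le> y" "1 \<le> x" "y \<le> n" for x y
    using that
  proof (induction y rule: dec_induct)
    case (step y)
    then have "(y, Suc y) \<in> parcs (path_power n k)" "(Suc y, y) \<in> parcs (path_power n k)"
      using assms(1) by (auto simp: arc_path_power_iff)
    then show ?case using step
      by (auto intro: rtrancl_into_rtrancl converse_rtrancl_into_rtrancl)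
  qed simp
  then show ?thesis using assms(2,3) by (cases u v rule: le_cases) auto
qed

lemma eccentricity_ge:
  assumes "1 \<le> k" and "u \<in> {1..n}" and "v \<in> {1..n}" and "v + k * e < u \<or> u + k * e < v"
  shows "Suc e \<le> eccentricity (path_power n k) v"
proof -
  let ?G = "path_power n k"
  obtain m where "(v, u) \<in> parcs ?G ^^ m"
    using path_power_connected[OF assms(1,3,2)] rtrancl_power by blast
  then have "(v, u) \<in> parcs ?G ^^ graph_dist ?G v u"
    unfolding graph_dist_def by (rule LeastI)
  from relpow_path_power_bound[OF this] have "k * e < k * graph_dist ?G v u"
    using assms(4) by linarith
  then have "Suc e \<le> graph_dist ?G v u" by auto
  also have "\<dots> \<le> eccentricity ?G v"
    unfolding eccentricity_def using assms(2) by (intro Max_ge) auto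
  finally show ?thesis .
qed

lemma solves_with_cost_mono:
  "solves_with_cost_at_most G C v x \<Longrightarrow> x \<le> y \<Longrightarrow> solves_with_cost_at_most G C v y"
  unfolding solves_with_cost_at_most_def by (meson le_trans)

text \<open>\<open>2 ^ \<alpha>\<close> pairs on the right, or \<open>2 ^ \<beta>\<close> on the
  left, suffice for \<open>one_sided_cost\<close>. For inner \<open>v\<close>,
  \<open>\<alpha> + \<beta> \<le> (n - 2) div k\<close> and \<open>2 ^ \<alpha> * 2 ^ \<beta> \<ge>
  2 ^ \<alpha> + 2 ^ \<beta> - 1\<close>, so the pairs cannot fall short on both sides.\<close>

lemma cost_of_pairs:
  fixes n k v :: nat and C :: "nat \<Rightarrow> nat"
  assumes n: "2 \<le> n" and k: "1 \<le> k" and v: "v \<in> {1..n}" and Cv: "C v = 0"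
    and pairs: "2 ^ ((n - 2) div k) \<le> (\<Sum>u=1..n. C u div 2)"
  shows "solves_with_cost_at_most (path_power n k) C v (2 ^ eccentricity (path_power n k) v)"
proof -
  define fr where "fr = (\<lambda>u. if v < u \<and> u \<le> n then C u div 2 else 0)"
  define fl where "fl = (\<lambda>u. if 1 \<le> u \<and> u < v then C u div 2 else 0)"
  define \<alpha> where "\<alpha> = (n - v - 1) div k"
  define \<beta> where "\<beta> = (v - 2) div k"
  have \<alpha>k: "k * \<alpha> \<le> n - v - 1" "n - v - 1 < k * Suc \<alpha>"
    and \<beta>k: "k * \<beta> \<le> v - 2" "v - 2 < k * Suc \<beta>"
    using k by (simp_all add: \<alpha>_def \<beta>_def dividend_less_times_div)
  have "(\<Sum>u=1..n. C u div 2) = (\<Sum>u=1..n. fr u + fl u)"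
  proof (rule sum.cong[OF refl])
    fix u assume "u \<in> {1..n}"
    then show "C u div 2 = fr u + fl u"
      using Cv by (cases u v rule: linorder_cases) (auto simp: fr_def fl_def)
  qed
  then have sum: "(\<Sum>u=1..n. C u div 2) = sum fr {1..n} + sum fl {1..n}"
    by (simp add: sum.distrib)
  have "v < n \<and> 2 ^ \<alpha> \<le> sum fr {1..n} \<or> 1 < v \<and> 2 ^ \<beta> \<le> sum fl {1..n}"
  proof (cases "1 < v \<and> v < n")
    case True
    have "(\<alpha> + \<beta>) * k \<le> n - 2"
      using \<alpha>k \<beta>k True by (auto simp: algebra_simps)
    then have "\<alpha> + \<beta> \<le> (n - 2) div k"
      using k by (simp add: less_eq_div_iff_mult_less_eq)
    then have "2 ^ (\<alpha> + \<beta>) \<le> (\<Sum>u=1..n. C u div 2)"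
      using pairs by (meson le_trans one_le_numeral power_increasing)
    moreover obtain A B where "2 ^ \<alpha> = Suc A" "2 ^ \<beta> = Suc B"
      by (metis Suc_pred pos2 zero_less_power)
    ultimately show ?thesis
      using sum True by (simp add: power_add) linarith
  next
    case False
    then consider "v = 1" | "v = n" using v by auto
    then show ?thesis
    proof cases
      case 1
      then have "sum fl {1..n} = 0" by (simp add: fl_def)
      then show ?thesis using 1 n pairs sum by (simp add: \<alpha>_def numeral_2_eq_2)
    next
      case 2
      then have "sum fr {1..n} = 0" by (simp add: fr_def)
      then show ?thesis using 2 n pairs sum by (simp add: \<beta>_def)
    qed
  qed
  then show ?thesis
  proof (elim disjE conjE)
    assume *: "v < n" "2 ^ \<alpha> \<le> sum fr {1..n}"
    have "solves_with_cost_at_most (path_power n k) C v (2 ^ Suc \<alpha>)"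
      by (rule one_sided_cost[OF v, of fr C True])
        (use * \<alpha>k in \<open>auto simp: fr_def split: if_splits\<close>)
    moreover have "Suc \<alpha> \<le> eccentricity (path_power n k) v"
      by (rule eccentricity_ge[OF k, of n]) (use * v n \<alpha>k in auto)
    ultimately show ?thesis
      by (meson one_le_numeral power_increasing solves_with_cost_mono)
  next
    assume *: "1 < v" "2 ^ \<beta> \<le> sum fl {1..n}"
    have "solves_with_cost_at_most (path_power n k) C v (2 ^ Suc \<beta>)"
      by (rule one_sided_cost[OF v, of fl C False])
        (use * v \<beta>k in \<open>auto simp: fl_def split: if_splits\<close>)
    moreover have "Suc \<beta> \<le> eccentricity (path_power n k) v"
      by (rule eccentricity_ge[OF k, of 1]) (use * v n \<beta>k in auto)
    ultimately show ?thesis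
      by (meson one_le_numeral power_increasing solves_with_cost_mono)
  qed
qed

text \<open>Strict length gives \<open>t - 1 \<ge> pp_t0 n k\<close>, so \<open>t - 1\<close> units
  of demand outweigh \<open>k * (d - 1)\<close> and one full \<open>2 ^ d\<close> is left over. The
  conclusion forces \<open>2 ^ (d - 1)\<close> pairs when at most \<open>n - 1\<close> vertices are
  odd.\<close>

lemma strictly_long_size:
  assumes n: "2 \<le> n" and k: "1 \<le> k" and long: "strictly_long t n k"
    and "s \<le> t" and "pp_bound t n k + 1 \<le> N + s"
  shows "2 * 2 ^ ((n - 2) div k) + n \<le> N + 1"
proof -
  define m where "m = (n - 2) div k"
  have km: "k * m \<le> n - 2" by (simp add: m_def)
  have bound: "t * 2 ^ Suc m + (n - 2 - k * m) + 1 \<le> N + s"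
    using assms(5) by (simp add: pp_bound_eq m_def)
  have t0: "pp_t0 n k \<le> real t - 1"
    using long unfolding strictly_long_def by linarith
  have "2 \<le> t \<and> k * m + 2 * (t - 1) \<le> (t - 1) * 2 ^ Suc m"
  proof (cases "m = 0")
    case True
    then show ?thesis using t0 by (simp add: pp_t0_def pp_d_Suc m_def)
  next
    case False
    have "0 < pp_t0 n k"
      using False k pp_t0_eq[of n k] two_less_power[OF False] unfolding m_def by simp
    then have t: "2 \<le> t" using t0 by linarith
    have "real k * real m \<le> (real t - 1) * (2 ^ Suc m - 2)"
      using t0 pp_t0_eq[of n k] False two_less_power[OF False]
      unfolding m_def by (simp add: pos_divide_le_eq)
    then have "real (k * m + 2 * (t - 1)) \<le> real ((t - 1) * 2 ^ Suc m)"
      using t by (simp add: algebra_simps of_nat_diff)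
    then show ?thesis using t of_nat_le_iff by blast
  qed
  moreover from this obtain t' where "t = Suc t'" "1 \<le> t'"
    by (metis Suc_le_D Suc_le_mono numeral_2_eq_2 One_nat_def)
  ultimately show ?thesis
    using bound \<open>s \<le> t\<close> km n by (simp add: m_def)
qed

theorem theorem30:
  fixes n k t :: nat and D :: "nat \<Rightarrow> nat"
  assumes "n \<ge> 2" and "k \<ge> 1" and "t \<ge> 1"
    and "dist_size (path_power n k) D = t"
  shows "int (pebbling_number (path_power n k) D)
           \<le> int (pp_bound t n k) - int (dist_support (path_power n k) D) + 1
       \<and> (wide t n k \<longrightarrow> small (path_power n k) D)
       \<and> (strictly_long t n k \<longrightarrow>
            (\<forall>C. int (dist_size (path_power n k) C)
                   \<ge> int (pp_bound t n k) - int (dist_support (path_power n k) D) + 1 \<longrightarrow>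
              (\<forall>v\<in>pverts (path_power n k). D v > 0 \<longrightarrow>
                 solves_with_cost_at_most (path_power n k) C v
                   (2 ^ eccentricity (path_power n k) v))))"
proof -
  let ?G = "path_power n k" and ?s = "dist_support (path_power n k) D"
  note n = assms(1) and k = assms(2) and t = assms(3,4)
  have upper: "solvable ?G D C" if "pp_bound t n k + 1 \<le> dist_size ?G C + ?s" for C
    using solvable_of_size[OF n k, of D t C] that t(2) by (simp add: dist_size_def dist_support_def)
  have s: "?s \<le> t" using dist_support_le_size[of ?G D] t(2) by simp
  \<comment> \<open>With \<open>?s \<le> t\<close> this keeps the natural-number subtraction below
    exact.\<close>
  have "t \<le> pp_bound t n k" by (simp add: pp_bound_def)
  have "pebbling_number ?G D \<le> pp_bound t n k + 1 - ?s"
    unfolding pebbling_number_def by (rule Least_le) (use upper in auto)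
  then have "int (pebbling_number ?G D) \<le> int (pp_bound t n k) - int ?s + 1"
    using s \<open>t \<le> pp_bound t n k\<close> by linarith
  moreover have "wide t n k \<longrightarrow> small ?G D"
    using small_path_power[OF n k t _ upper] by blast
  moreover have "solves_with_cost_at_most ?G C v (2 ^ eccentricity ?G v)"
    if long: "strictly_long t n k"
      and size: "int (dist_size ?G C) \<ge> int (pp_bound t n k) - int ?s + 1"
      and v: "v \<in> pverts ?G" for C v
  proof (cases "C v = 0")
    case True
    have "sum C {1..n} = 2 * (\<Sum>u=1..n. C u div 2) + (\<Sum>u=1..n. C u mod 2)"
      by (rule sum_pairs)
    \<comment> \<open>The empty vertex \<open>v\<close> carries no odd pebble, which leaves at most
      \<open>n - 1\<close> of them.\<close>
    moreover have "(\<Sum>u=1..n. C u mod 2) = (\<Sum>u\<in>{1..n} - {v}. C u mod 2)"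
      using v True by (simp add: sum.remove[of _ v])
    moreover have "(\<Sum>u\<in>{1..n} - {v}. C u mod 2) \<le> (\<Sum>u\<in>{1..n} - {v}. 1)"
      by (intro sum_mono) simp
    moreover have "2 * 2 ^ ((n - 2) div k) + n \<le> dist_size ?G C + 1"
      using size by (intro strictly_long_size[OF n k long s]) linarith
    ultimately have "2 ^ ((n - 2) div k) \<le> (\<Sum>u=1..n. C u div 2)"
      using v n by (simp add: dist_size_def)
    then show ?thesis using cost_of_pairs[of n k v C] n k v True by simp
  next
    case False
    \<comment> \<open>A pebble already on \<open>v\<close> needs no step and has cost
      \<open>1\<close>.\<close>
    then show ?thesis
      unfolding solves_with_cost_at_most_def by (intro exI[of _ 0] exI[of _ C]) simp
  qed
  ultimately show ?thesis by blast
qed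

end
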